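(* Let $n,m_1,m_2,k \in \mathbb{Z}$ be integers such that $n \geq 4$, neither $k$ nor $m_1-m_2$ is divisible by $n$, and $\gcd(n,k,m_1-m_2)=1$. If $n$ is even, assume moreover that $n > 2\gcd(n,k)\gcd(n,m_1-m_2)$. Let $P=(p_1,p_2,\ldots,p_n)$ be an $n$-gon in $\mathbb{C}$ (with pairwise distinct vertices, indices understood modulo $n$) for which there is some $w \in \mathbb{C}$ with $|w| \neq 1$, independent of $j$, such that $$p_{j+m_1}-p_{j+m_2} = w\,(p_{j+k}-p_j) \quad \text{for } j=1,2,\ldots,n.$$ Then: (1) If $w \notin \mathbb{R}$, then $P$ is a regular $n$-gon, and $m_1+m_2 \not\equiv k \pmod n$. (2) If $w \in \mathbb{R}$, then $P$ is an affinely regular $n$-gon, and $m_1+m_2 \equiv k \pmod n$.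
   Context: The Euclidean plane $\mathbb{R}^2$ is identified with $\mathbb{C}$. For $n \geq 4$, an $n$-gon $P=(p_1,\ldots,p_n)$ is an ordered $n$-tuple of points of $\mathbb{C}$, where the indices of the points are understood modulo $n$; the points $p_1,\ldots,p_n$ are called its vertices. Throughout, only $n$-gons whose vertices are pairwise distinct are considered. The $n$-gon $P=(p_1,\ldots,p_n)$ is called affinely regular (respectively, regular) if there is an affine transformation (respectively, an isometry) $\phi$ of the plane $\mathbb{R}^2 = \mathbb{C}$ such that $\phi(p_j)=p_{j+1}$ for $j=1,2,\ldots,n$. (In particular, regular star polygons $(1,\epsilon^t,\epsilon^{2t},\ldots,\epsilon^{(n-1)t})$ with $\epsilon = \cos\frac{2\pi}{n}+i\sin\frac{2\pi}{n}$ and $t$ relatively prime to $n$ count as regular.) For nonzero integers, $\gcd$ denotes the greatest positive common divisor.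
   Formalization: In (2), affine regularity of P is asserted only when the vertices are not collinear: collinear P can satisfy all hypotheses (n=5, k=1, m_1=2, m_2=-1, points 1,0,-1,-t,t with t=(√5-1)/2, w=1+t) but are never affinely regular. *)

theory Defs
  imports "HOL-Analysis.Analysis" "HOL-Number_Theory.Cong"
begin

(* The plane is the type complex, regarded as a real vector space. An n-gon (p_1, ..., p_n) is
   encoded as an n-periodic function on the integers, so that indices are read modulo n. *)
definition ngon :: "int \<Rightarrow> (int \<Rightarrow> complex) \<Rightarrow> bool" where
  "ngon n p \<longleftrightarrow> n \<ge> 4 \<and> (\<forall>j. p (j + n) = p j) \<and> inj_on p {1..n}"

(* linear means linear over the reals; it need not be linear over the complex numbers. *)
definition affine_transformation :: "(complex \<Rightarrow> complex) \<Rightarrow> bool" where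
  "affine_transformation \<phi> \<longleftrightarrow> (\<exists>L c. linear L \<and> bij L \<and> \<phi> = (\<lambda>z. L z + c))"

definition plane_isometry :: "(complex \<Rightarrow> complex) \<Rightarrow> bool" where
  "plane_isometry \<phi> \<longleftrightarrow> (\<forall>x y. dist (\<phi> x) (\<phi> y) = dist x y)"

(* The vertices of an affinely regular n-gon are never collinear: otherwise the affine
   transformation would restrict to an affine map of a line having an orbit of finite length
   n \<ge> 4, whereas such an orbit has length at most 2. *)
definition affinely_regular_ngon :: "int \<Rightarrow> (int \<Rightarrow> complex) \<Rightarrow> bool" where
  "affinely_regular_ngon n p \<longleftrightarrow>
     ngon n p \<and> (\<exists>\<phi>. affine_transformation \<phi> \<and> (\<forall>j\<in>{1..n}. \<phi> (p j) = p (j + 1)))"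

definition regular_ngon :: "int \<Rightarrow> (int \<Rightarrow> complex) \<Rightarrow> bool" where
  "regular_ngon n p \<longleftrightarrow>
     ngon n p \<and> (\<exists>\<phi>. plane_isometry \<phi> \<and> (\<forall>j\<in>{1..n}. \<phi> (p j) = p (j + 1)))"

end

(* Write e(x) = exp(2 pi i x / n). The discrete Fourier transform decouples the hypothesis: a
   frequency s occurring in P must satisfy e(s m2) (e(s m) - 1) = w (e(s k) - 1), where
   m = m1 - m2. Everything reduces to showing that at most one pair {s, -s} of nonzero frequencies
   occurs; then P is the image of a regular (star) polygon under z |-> C + A z + B cnj z, where B = 0
   when w is not real, because s and -s lead to conjugate values of w.

   Two frequencies s, t give a relation e(D) (e(a) - 1) (e(b) - 1) = (e(c) - 1) (e(d) - 1) with
   a = s m, b = t k, c = t m, d = s k. Applying well-chosen automorphisms of the n-th cyclotomic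
   field yields further relations, which force {|e(a) - 1|, |e(b) - 1|} = {|e(c) - 1|, |e(d) - 1|}:
   for odd n squaring of roots of unity suffices, for 4 | n one uses e(1) |-> -e(1) and divisibility
   by 2 in Z[e(1)], and for n = 2 h with h odd one splits off the sign and iterates the squaring of
   the part of odd order. Since |w| <> 1, this means s m = +-t m and s k = +-t k modulo n. Equal signs
   give s = +-t; opposite signs are impossible for odd n and make n divide
   2 gcd(n,k) gcd(n,m) for even n. *)
theory Submission
  imports Defs "HOL-Computational_Algebra.Polynomial_Factorial"
begin

section \<open>Galois conjugation of roots of unity\<close>

text \<open>The product of two chord lengths alone identifies nothing: with
  \<open>chord_sq n x\<close> = 4 sin^2 (\<pi> x / n) the relation yields A B = C D, and only A + B
  = C + D in addition makes {A, B} and {C, D} the roots of one quadratic. The automorphisms have to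
  supply this sum. Doubling the angle sends X to X (4 - X), which is enough whenever 2 is invertible
  modulo n; even n lacks this automorphism, hence the detours there. A second obstacle is that two
  frequencies s, t may share a factor d with n. Dividing it out shows only that n divides d * G,
  where G = 2 gcd(n,k) gcd(n,m). Since the vertices are distinct, no prime q of n divides all
  non-zero frequencies. So if two frequencies differed even up to sign, every q would have such a
  pair with d prime to q, and together these pairs would make n divide G, against the assumption on
  even n; for odd n this alternative never arises.\<close>

definition int_eval :: "complex \<Rightarrow> int poly \<Rightarrow> complex" where
  "int_eval z F = poly (map_poly of_int F) z"

lemma int_eval_0 [simp]: "int_eval z 0 = 0"
  by (simp add: int_eval_def)

lemma int_eval_pCons [simp]: "int_eval z (pCons a F) = of_int a + z * int_eval z F"
  by (simp add: int_eval_def map_poly_pCons)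

lemma int_eval_1 [simp]: "int_eval z 1 = 1"
  by (simp add: one_pCons)

lemma int_eval_add [simp]: "int_eval z (F + G) = int_eval z F + int_eval z G"
  by (induction F G rule: poly_induct2) (simp_all add: algebra_simps)

lemma int_eval_smult [simp]: "int_eval z (smult c F) = of_int c * int_eval z F"
  by (induction F) (simp_all add: algebra_simps)

lemma int_eval_uminus [simp]: "int_eval z (- F) = - int_eval z F"
  using int_eval_smult[of z "-1" F] by simp

lemma int_eval_diff [simp]: "int_eval z (F - G) = int_eval z F - int_eval z G"
  using int_eval_add[of z F "- G"] by simp

lemma int_eval_mult [simp]: "int_eval z (F * G) = int_eval z F * int_eval z G"
  by (induction F) (simp_all add: algebra_simps)

lemma int_eval_power [simp]: "int_eval z (F ^ n) = int_eval z F ^ n"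
  by (induction n) simp_all

lemma int_eval_monom [simp]: "int_eval z (monom c n) = of_int c * z ^ n"
  by (induction n) (simp_all add: monom_0 monom_Suc)

lemma int_eval_pcompose [simp]: "int_eval z (pcompose F G) = int_eval (int_eval z G) F"
  by (induction F) (simp_all add: pcompose_pCons algebra_simps)

lemma int_eval_sum [simp]: "int_eval z (sum F A) = (\<Sum>i\<in>A. int_eval z (F i))"
  by (induction A rule: infinite_finite_induct) simp_all

section \<open>The Frobenius congruence modulo a prime\<close>

lemma prime_dvd_binomial_power:
  fixes A B :: "'a :: comm_ring_1"
  assumes "prime p"
  shows "of_nat p dvd (A + B) ^ p - (A ^ p + B ^ p)"
proof -
  have p: "p \<ge> 2" using assms by (rule prime_ge_2_nat)
  have "(A + B) ^ p = (\<Sum>k\<le>p. of_nat (p choose k) * A ^ k * B ^ (p - k))"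
    by (rule binomial_ring)
  also have "{..p} = insert 0 (insert p {0<..<p})" using p by auto
  also have "(\<Sum>k\<in>\<dots>. of_nat (p choose k) * A ^ k * B ^ (p - k))
      = B ^ p + (A ^ p + (\<Sum>k\<in>{0<..<p}. of_nat (p choose k) * A ^ k * B ^ (p - k)))"
    using p by simp
  finally have "(A + B) ^ p - (A ^ p + B ^ p) =
      (\<Sum>k\<in>{0<..<p}. of_nat (p choose k) * A ^ k * B ^ (p - k))" by simp
  moreover have dvd: "of_nat p dvd of_nat (p choose k) * A ^ k * B ^ (p - k)" if "k \<in> {0<..<p}" for k
  proof -
    have "p dvd p choose k" using that assms by (intro dvd_choose_prime) auto
    then have "(of_nat p :: 'a) dvd of_nat (p choose k)" by (metis dvd_def of_nat_mult)
    then show ?thesis by (simp add: mult.assoc)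
  qed
  moreover have "of_nat p dvd (\<Sum>k\<in>{0<..<p}. of_nat (p choose k) * A ^ k * B ^ (p - k))"
    using dvd by (rule dvd_sum)
  ultimately show ?thesis by simp
qed

lemma prime_dvd_int_power_diff:
  fixes a :: int
  assumes "prime p"
  shows "int p dvd a ^ p - a"
proof (induction a rule: int_induct[of _ 0])
  case base
  then show ?case using prime_gt_0_nat[OF assms] by (simp add: zero_power)
next
  case (step1 i)
  have "int p dvd (i + 1) ^ p - (i ^ p + 1)" using prime_dvd_binomial_power[OF assms, of i 1] by simp
  from dvd_add[OF this step1(2)] show ?case by (simp add: algebra_simps)
next
  case (step2 i)
  have "int p dvd i ^ p - ((i - 1) ^ p + 1)" using prime_dvd_binomial_power[OF assms, of "i-1" 1] by simp
  from dvd_diff[OF step2(2) this] show ?case by (simp add: algebra_simps)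
qed

text \<open>Raising to the p-th power is additive modulo p and fixes integer coefficients by
  Fermat's little theorem; the induction follows Horner's scheme.\<close>

lemma prime_dvd_pcompose_monom_diff:
  fixes F :: "int poly"
  assumes "prime p"
  shows "of_nat p dvd pcompose F (monom 1 p) - F ^ p"
proof (induction F)
  case 0
  then show ?case using prime_gt_0_nat[OF assms] by (simp add: zero_power)
next
  case (pCons a F)
  have *: "pCons a F = [:a:] + monom 1 1 * F" by (simp add: monom_Suc monom_0)
  have 1: "of_nat p dvd (pCons a F) ^ p - ([:a:] ^ p + monom 1 p * F ^ p)"
    using prime_dvd_binomial_power[OF assms, of "[:a:]" "monom 1 1 * F"]
    by (simp add: * power_mult_distrib monom_power)
  obtain c where c: "a ^ p - a = int p * c" using prime_dvd_int_power_diff[OF assms] by (metis dvdE)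
  have "[:a:] ^ p - [:a:] = of_nat p * [:c:]"
    using c by (simp add: poly_const_pow of_nat_poly)
  then have 2: "(of_nat p :: int poly) dvd [:a:] ^ p - [:a:]" by (metis dvd_triv_left)
  have 3: "of_nat p dvd monom 1 p * (pcompose F (monom 1 p) - F ^ p)" using pCons by simp
  have "pcompose (pCons a F) (monom 1 p) - pCons a F ^ p =
     monom 1 p * (pcompose F (monom 1 p) - F ^ p) - ([:a:] ^ p - [:a:])
      - ((pCons a F) ^ p - ([:a:] ^ p + monom 1 p * F ^ p))"
    by (simp add: pcompose_pCons algebra_simps)
  with 1 2 3 show ?case by (metis dvd_diff)
qed

text \<open>The minimal polynomial over the integers. The primitive part of an annihilator of least
  degree divides all others, by pseudo-division and multiplicativity of the content (Gauss). As it
  divides the monic X^N - 1, its leading coefficient is 1 or -1.\<close>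

lemma root_of_unity_monic_annihilator:
  fixes z :: complex
  assumes "z ^ N = 1" and "N > 0"
  obtains f :: "int poly" where "lead_coeff f = 1" "degree f > 0" "int_eval z f = 0"
    "\<And>F. int_eval z F = 0 \<longleftrightarrow> f dvd F"
proof -
  define Q where "Q d \<longleftrightarrow> (\<exists>F. F \<noteq> 0 \<and> int_eval z F = 0 \<and> degree F = d)" for d
  define g0 :: "int poly" where "g0 = monom 1 N - 1"
  have g0: "int_eval z g0 = 0" using assms by (simp add: g0_def)
  have g0N: "coeff g0 N = 1" using assms by (simp add: g0_def)
  then have "g0 \<noteq> 0" by auto
  with g0 have "Q (degree g0)" by (auto simp: Q_def)
  define d where "d = (LEAST d. Q d)"
  have "Q d" unfolding d_def using \<open>Q (degree g0)\<close> by (rule LeastI)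
  then obtain F where F: "F \<noteq> 0" "int_eval z F = 0" "degree F = d" by (auto simp: Q_def)
  define g where "g = primitive_part F"
  have FG: "F = smult (content F) g" by (simp add: g_def)
  have cF: "content F \<noteq> 0" using F by simp
  have g: "g \<noteq> 0" "degree g = d" "content g = 1" using F by (auto simp: g_def)
  have gz: "int_eval z g = 0" using F(2) cF by (subst (asm) FG) simp
  have red: "G = 0" if "int_eval z G = 0" "G = 0 \<or> degree G < d" for G
  proof (rule ccontr)
    assume "G \<noteq> 0"
    with that have "degree G < d" "Q (degree G)" by (auto simp: Q_def)
    then show False unfolding d_def using not_less_Least by blast
  qed
  have dvd: "g dvd G" if G: "int_eval z G = 0" for G
  proof -
    obtain a q where aq: "a \<noteq> 0" "smult a G = g * q + pseudo_mod G g"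
      using pseudo_mod(1)[OF g(1)] by blast
    have "int_eval z (pseudo_mod G g) = int_eval z (smult a G) - int_eval z (g * q)"
      by (subst aq(2)) simp
    also have "\<dots> = 0" using G gz by simp
    finally have "pseudo_mod G g = 0" using red pseudo_mod(2)[OF g(1), of G] g(2) by simp
    with aq have eq: "smult a G = g * q" by simp
    then have "content (smult a G) = content q" using g by (simp add: content_mult)
    then have "a dvd content q" by (metis content_smult dvd_normalize_iff dvd_triv_left dvd_trans normalize_dvd_iff dvd_mult2 mult.commute)
    then have "[:a:] dvd q" by (simp add: const_poly_dvd_iff_dvd_content)
    then obtain q' where "q = smult a q'" by (auto elim!: dvdE)
    with eq have "smult a G = smult a (g * q')" by simp
    with aq(1) have "G = g * q'" by (metis smult_cancel)
    then show ?thesis by simp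
  qed
  from dvd[OF g0] obtain h where h: "g0 = g * h" by (elim dvdE)
  have dg0: "degree g0 = N"
  proof (rule antisym)
    show "degree g0 \<le> N" unfolding g0_def by (intro degree_diff_le) (simp_all add: degree_monom_le)
    show "N \<le> degree g0" using g0N by (intro le_degree) simp
  qed
  have "lead_coeff g * lead_coeff h = 1" using h g0N dg0 by (metis lead_coeff_mult)
  then have l: "lead_coeff g = 1 \<or> lead_coeff g = -1" by (metis zmult_eq_1_iff)
  define f where "f = smult (lead_coeff g) g"
  have l2: "lead_coeff g * lead_coeff g = 1" using l by auto
  have gf: "g = smult (lead_coeff g) f" by (simp add: f_def l2)
  have fdvd: "f dvd G \<longleftrightarrow> g dvd G" for G
    by (metis dvd_smult dvd_trans dvd_refl f_def gf)
  have fz: "int_eval z f = 0" using gz by (simp add: f_def)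
  have "degree f > 0"
  proof (rule ccontr)
    assume "\<not> degree f > 0"
    then obtain c where "f = [:c:]" by (metis degree_eq_zeroE gr0I)
    moreover have "f \<noteq> 0" using g l by (auto simp: f_def)
    ultimately show False using fz by auto
  qed
  moreover have "lead_coeff f = 1" using l by (auto simp: f_def)
  moreover have "int_eval z G = 0 \<longleftrightarrow> f dvd G" for G
    using dvd[of G] fdvd[of G] gz by (auto elim!: dvdE)
  ultimately show ?thesis using that fz by blast
qed

text \<open>The range of \<open>int_eval z\<close> is the ring Z[z], in which the only rational
  numbers are integers. Modulo the monic f, G reduces to a remainder r of smaller degree; p r - M
  then annihilates z in too small a degree, so it is zero.\<close>

lemma int_eval_eq_int_dvd:
  assumes "z ^ N = 1" and "N > 0" and "of_int p * int_eval z G = of_int M"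
  shows "p dvd M"
proof -
  obtain f where f: "lead_coeff f = 1" "degree f > 0" "int_eval z f = 0"
    "\<And>F. int_eval z F = 0 \<longleftrightarrow> f dvd F"
    using root_of_unity_monic_annihilator assms(1,2) by metis
  have f0: "f \<noteq> 0" using f by auto
  obtain q r where qr: "pseudo_divmod G f = (q, r)" by fastforce
  have Gqr: "G = f * q + r" "r = 0 \<or> degree r < degree f"
    using pseudo_divmod[OF f0 qr] f(1) by auto
  define H where "H = smult p r - [:M:]"
  have "int_eval z G = int_eval z r" using Gqr(1) f(3) by simp
  then have "int_eval z H = 0" using assms(3) by (simp add: H_def)
  then have "f dvd H" using f(4) by simp
  moreover have "degree H < degree f"
    using Gqr(2) f(2) unfolding H_def
    by (intro degree_diff_less) (auto intro: le_less_trans[OF degree_smult_le])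
  ultimately have "H = 0" using dvd_imp_degree_le[of f H] by fastforce
  then have "coeff (smult p r) 0 = M" by (simp add: H_def)
  then show ?thesis by auto
qed

text \<open>Dedekind's argument. If the minimal polynomial \<open>f\<close> of \<open>z\<close> does not vanish at \<open>z ^ p\<close>, then its
  cofactor in \<open>x ^ N - 1\<close> does, so \<open>f(z ^ p)\<close> divides the derivative \<open>N x ^ (N - 1)\<close> at \<open>z ^ p\<close>; but
  \<open>p\<close> divides \<open>f(z ^ p) = f(z ^ p) - f(z) ^ p\<close>.\<close>

lemma int_eval_power_prime_eq_0:
  assumes z: "z ^ N = 1" "N > 0" and p: "prime p" "\<not> p dvd N" and F: "int_eval z F = 0"
  shows "int_eval (z ^ p) F = 0"
proof -
  obtain f where f: "lead_coeff f = 1" "degree f > 0" "int_eval z f = 0"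
    "\<And>F. int_eval z F = 0 \<longleftrightarrow> f dvd F"
    using root_of_unity_monic_annihilator z by metis
  have "int_eval (z ^ p) f = 0"
  proof (rule ccontr)
    assume neq: "int_eval (z ^ p) f \<noteq> 0"
    define g :: "int poly" where "g = monom 1 N - 1"
    have "int_eval z g = 0" using z by (simp add: g_def)
    then have "f dvd g" using f(4) by simp
    then obtain h where h: "g = f * h" by (elim dvdE)
    have zp: "(z ^ p) ^ N = 1" using z by (metis power_mult mult.commute power_one)
    then have "int_eval (z ^ p) g = 0" by (simp add: g_def)
    with h neq have h0: "int_eval (z ^ p) h = 0" by simp
    obtain W where W: "pcompose f (monom 1 p) - f ^ p = of_nat p * W"
      using prime_dvd_pcompose_monom_diff[OF p(1)] by (metis dvdE)
    have "int_eval z (pcompose f (monom 1 p) - f ^ p) = int_eval (z ^ p) f"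
      using f(3) p prime_gt_0_nat by simp
    then have fp: "int_eval (z ^ p) f = of_nat p * int_eval z W" by (simp add: W of_nat_poly)
    have "pderiv g = f * pderiv h + h * pderiv f" by (simp add: h pderiv_mult)
    then have "int_eval (z ^ p) (pderiv g) = int_eval (z ^ p) f * int_eval (z ^ p) (pderiv h)"
      using h0 by simp
    moreover have "int_eval (z ^ p) (pderiv g) = of_nat N * (z ^ p) ^ (N - 1)"
      by (simp add: g_def pderiv_diff pderiv_monom)
    ultimately have eq: "of_nat N * (z ^ p) ^ (N - 1)
      = of_nat p * int_eval z W * int_eval (z ^ p) (pderiv h)" using fp by simp
    \<comment> \<open>One more factor z^p turns the derivative N x^(N-1) at x = z^p into the integer
      N, to which \<open>int_eval_eq_int_dvd\<close> applies.\<close>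
    have zN: "(z ^ p) ^ (N - 1) * z ^ p = 1" using zp z(2)
      by (metis mult.commute power_eq_if less_numeral_extra(3))
    have "of_int (int p) * int_eval z (W * pcompose (pderiv h) (monom 1 p) * monom 1 p)
      = of_nat p * int_eval z W * int_eval (z ^ p) (pderiv h) * z ^ p" by simp
    also have "\<dots> = of_nat N * (z ^ p) ^ (N - 1) * z ^ p" by (simp only: eq)
    also have "\<dots> = of_nat N * ((z ^ p) ^ (N - 1) * z ^ p)" by (simp only: mult.assoc)
    also have "\<dots> = of_int (int N)" using zN by simp
    finally have "of_int (int p) * int_eval z (W * pcompose (pderiv h) (monom 1 p) * monom 1 p)
      = of_int (int N)" .
    then have "int p dvd int N" by (rule int_eval_eq_int_dvd[OF z])
    with p show False by simp
  qed
  moreover have "f dvd F" using F f(4) by simp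
  ultimately show ?thesis by (auto elim!: dvdE)
qed

lemma int_eval_power_coprime_eq_0:
  assumes "z ^ N = 1" "N > 0" "coprime u N" "u > 0" "int_eval z F = 0"
  shows "int_eval (z ^ u) F = 0"
  using assms
\<comment> \<open>The root has to vary: splitting a prime p off the exponent replaces z by
  z^p.\<close>
proof (induction u arbitrary: z rule: prime_divisors_induct)
  case zero
  then show ?case by simp
next
  case (unit u)
  then show ?case by simp
next
  case (factor p u)
  have "\<not> p dvd N"
    using factor.prems(3) factor.hyps by (metis coprime_mult_left_iff coprime_absorb_left not_prime_unit)
  then have "int_eval (z ^ p) F = 0"
    using factor.prems factor.hyps by (intro int_eval_power_prime_eq_0) auto
  moreover have "(z ^ p) ^ N = 1" using factor.prems(1) by (metis power_mult mult.commute power_one)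
  ultimately have "int_eval ((z ^ p) ^ u) F = 0"
    using factor.prems by (intro factor.IH) auto
  then show ?case by (simp add: power_mult)
qed

section \<open>Roots of unity with exponents modulo n\<close>

definition unit_root :: "int \<Rightarrow> int \<Rightarrow> complex" where
  "unit_root n x = cis (2 * pi * of_int x / of_int n)"

lemma unit_root_0 [simp]: "unit_root n 0 = 1"
  by (simp add: unit_root_def)

lemma unit_root_add: "unit_root n (x + y) = unit_root n x * unit_root n y"
  by (simp add: unit_root_def cis_mult add_divide_distrib distrib_left)

lemma unit_root_uminus: "unit_root n (- x) = cnj (unit_root n x)"
  by (simp add: unit_root_def cis_cnj)

lemma unit_root_uminus_inverse: "unit_root n (- x) = inverse (unit_root n x)"
  by (simp add: unit_root_def)

lemma norm_unit_root [simp]: "norm (unit_root n x) = 1"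
  by (simp add: unit_root_def)

lemma unit_root_nonzero [simp]: "unit_root n x \<noteq> 0"
  by (simp add: unit_root_def)

lemma unit_root_diff: "unit_root n (x - y) = unit_root n x / unit_root n y"
  using unit_root_add[of n x "-y"] by (simp add: unit_root_uminus_inverse divide_inverse)

lemma unit_root_power: "unit_root n x ^ k = unit_root n (int k * x)"
  by (induction k) (simp_all add: unit_root_add algebra_simps)

lemma unit_root_eq_1_iff:
  assumes "n > 0"
  shows "unit_root n x = 1 \<longleftrightarrow> n dvd x"
proof -
  have "unit_root n x = 1 \<longleftrightarrow> cos (2 * pi * of_int x / of_int n) = 1"
    by (auto simp: unit_root_def complex_eq_iff intro: cos_one_sin_zero)
  also have "\<dots> \<longleftrightarrow> (\<exists>k::int. 2 * pi * of_int x / of_int n = of_int k * 2 * pi)"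
    by (rule cos_one_2pi_int)
  also have "\<dots> \<longleftrightarrow> (\<exists>k::int. real_of_int x = real_of_int (n * k))"
    using assms by (intro ex_cong1) (auto simp: field_simps)
  also have "\<dots> \<longleftrightarrow> n dvd x" unfolding of_int_eq_iff dvd_def ..
  finally show ?thesis .
qed

lemma unit_root_eq_iff:
  assumes "n > 0"
  shows "unit_root n x = unit_root n y \<longleftrightarrow> n dvd x - y"
  using unit_root_eq_1_iff[OF assms, of "x - y"] by (simp add: unit_root_diff)

lemma unit_root_mult_cancel:
  assumes "d \<noteq> 0"
  shows "unit_root (d * n) (d * x) = unit_root n x"
  using assms by (simp add: unit_root_def mult.assoc)

lemma unit_root_half:
  assumes "n > 0" shows "unit_root (2 * n) n = -1"
  using assms by (simp add: unit_root_def)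

text \<open>The automorphism e(1) |-> e(u) without field theory: with exponents reduced modulo n the
  sum is an integer polynomial in e(1), and a polynomial vanishing at e(1) vanishes at
  e(1)^u.\<close>

lemma galois_conjugate_sum:
  assumes n: "n > 0" and u: "coprime u n"
    and sum: "(\<Sum>i\<in>I. of_int (c i) * unit_root n (x i)) = 0"
  shows "(\<Sum>i\<in>I. of_int (c i) * unit_root n (u * x i)) = 0"
proof -
  define F :: "int poly" where "F = (\<Sum>i\<in>I. monom (c i) (nat (x i mod n)))"
  \<comment> \<open>The summand \<open>nat n\<close> keeps the exponent positive, also for n = 1,
    where u mod n is 0.\<close>
  define v where "v = nat (u mod n) + nat n"
  have ev: "int_eval (unit_root n y) F = (\<Sum>i\<in>I. of_int (c i) * unit_root n (y * x i))" for y
  proof -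
    have "unit_root n y ^ nat (x i mod n) = unit_root n (y * x i)" for i
    proof -
      have "unit_root n y ^ nat (x i mod n) = unit_root n ((x i mod n) * y)"
        using n by (simp add: unit_root_power)
      also have "\<dots> = unit_root n (y * x i)"
      proof -
        have "(x i mod n) * y - y * x i = n * (- y * (x i div n))"
          by (simp add: minus_mult_div_eq_mod[symmetric] algebra_simps)
        then show ?thesis using n by (simp add: unit_root_eq_iff)
      qed
      finally show ?thesis .
    qed
    then show ?thesis by (simp add: F_def)
  qed
  have v: "v > 0" "int v = u mod n + n" using n by (auto simp: v_def)
  have "int_eval (unit_root n 1 ^ v) F = 0"
  proof (rule int_eval_power_coprime_eq_0)
    show "unit_root n 1 ^ nat n = 1" using n by (simp add: unit_root_power unit_root_eq_1_iff)
    have "coprime (int v) n" unfolding v(2) using u n coprime_mod_left_iff[of n u] by (simp add: coprime_iff_gcd_eq_1)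
    then have "coprime (int v) (int (nat n))" using n by simp
    then show "coprime v (nat n)" by (simp only: coprime_int_iff)
  qed (use n v sum ev[of 1] in auto)
  also have "unit_root n 1 ^ v = unit_root n u"
  proof -
    have "int v - u = n * (1 - u div n)"
      by (simp add: v(2) minus_mult_div_eq_mod[symmetric] algebra_simps)
    then show ?thesis using n by (simp add: unit_root_power unit_root_eq_iff)
  qed
  finally show ?thesis by (simp add: ev)
qed

section \<open>Relations between four chords\<close>

text \<open>This is 4 sin^2 (\<pi> x / n), the squared length of a chord
  (\<open>chord_sq_norm\<close>). Written through roots of unity it can be conjugated, unlike an
  absolute value.\<close>

definition chord_sq :: "int \<Rightarrow> int \<Rightarrow> complex" where
  "chord_sq n x = (unit_root n x - 1) * (unit_root n (- x) - 1)"

lemma chord_sq_altdef: "chord_sq n x = 2 - unit_root n x - unit_root n (- x)"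
  by (simp add: chord_sq_def unit_root_uminus_inverse algebra_simps)

lemma chord_sq_norm: "chord_sq n x = of_real ((norm (unit_root n x - 1))\<^sup>2)"
  unfolding chord_sq_def unit_root_uminus
  by (metis complex_cnj_diff complex_cnj_one complex_norm_square)

lemma chord_sq_eq_0_iff: "n > 0 \<Longrightarrow> chord_sq n x = 0 \<longleftrightarrow> n dvd x"
  by (simp add: chord_sq_def unit_root_eq_1_iff)

lemma chord_sq_eq_iff:
  assumes "n > 0"
  shows "chord_sq n x = chord_sq n y \<longleftrightarrow> n dvd x - y \<or> n dvd x + y"
proof -
  have "chord_sq n x = chord_sq n y \<longleftrightarrow>
     (unit_root n x - unit_root n y) * (1 - unit_root n x * unit_root n y) = 0"
    by (simp add: chord_sq_altdef unit_root_uminus_inverse field_simps)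
  also have "\<dots> \<longleftrightarrow> unit_root n x = unit_root n y \<or> unit_root n (x + y) = 1"
    by (auto simp: unit_root_add)
  finally show ?thesis using assms by (simp add: unit_root_eq_iff unit_root_eq_1_iff)
qed

lemma chord_sq_double: "chord_sq n (2 * x) = chord_sq n x * (4 - chord_sq n x)"
proof -
  have "unit_root n (2 * x) = unit_root n x ^ 2" "unit_root n (- (2 * x)) = unit_root n (- x) ^ 2"
    by (simp_all add: unit_root_power)
  moreover have "unit_root n x * unit_root n (- x) = 1" by (simp add: unit_root_uminus_inverse)
  ultimately show ?thesis unfolding chord_sq_altdef by algebra
qed

lemma unit_root_half_mult:
  assumes "h > 0"
  shows "unit_root (2 * h) (h * x) = (if even x then 1 else - 1)"
proof (cases "even x")
  case True
  then obtain y where "x = 2 * y" by (elim evenE)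
  then show ?thesis using assms by (simp add: unit_root_eq_1_iff)
next
  case False
  then obtain y where "x = 2 * y + 1" by (elim oddE)
  moreover have "unit_root (2 * h) (2 * h * y) = 1"
    using assms by (simp add: unit_root_eq_1_iff)
  ultimately show ?thesis using unit_root_half[OF assms]
    by (simp add: distrib_left unit_root_add mult_ac)
qed

lemma equal_sum_prod_cases:
  fixes A B C D :: "'a :: idom"
  assumes "A * B = C * D" "A + B = C + D"
  shows "A = C \<and> B = D \<or> A = D \<and> B = C"
proof -
  have "(A - C) * (A - D) = 0" using assms by algebra
  then show ?thesis using assms(2) by auto
qed

locale root_relation =
  fixes n a b c d D :: int
  assumes n_pos: "n > 0"
    and nz: "\<not> n dvd a" "\<not> n dvd b" "\<not> n dvd c" "\<not> n dvd d"
    and rel: "unit_root n D * ((unit_root n a - 1) * (unit_root n b - 1)) =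
              (unit_root n c - 1) * (unit_root n d - 1)"
begin

lemma chord_nz:
  "chord_sq n a \<noteq> 0" "chord_sq n b \<noteq> 0" "chord_sq n c \<noteq> 0" "chord_sq n d \<noteq> 0"
  using nz n_pos by (simp_all add: chord_sq_eq_0_iff)

lemma rel_conj:
  assumes "coprime u n"
  shows "unit_root n (u * D) * ((unit_root n (u * a) - 1) * (unit_root n (u * b) - 1)) =
         (unit_root n (u * c) - 1) * (unit_root n (u * d) - 1)"
proof -
  \<comment> \<open>The expanded relation has eight monomials: \<open>cs\<close> lists their signs,
    \<open>xs\<close> their exponents.\<close>
  define cs where "cs i = [1, -1, -1, 1, -1, 1, 1, -1::int] ! i" for i
  define xs where "xs i = [D + a + b, D + a, D + b, D, c + d, c, d, 0] ! i" for i
  have expand: "(\<Sum>i<8. of_int (cs i) * unit_root n (v * xs i)) =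
      unit_root n (v * D) * ((unit_root n (v * a) - 1) * (unit_root n (v * b) - 1)) -
      (unit_root n (v * c) - 1) * (unit_root n (v * d) - 1)" for v
    by (simp add: cs_def xs_def eval_nat_numeral distrib_left unit_root_add)
       (simp add: algebra_simps)
  have "(\<Sum>i<8. of_int (cs i) * unit_root n (xs i)) = 0"
    using expand[of 1] rel by simp
  then have "(\<Sum>i<8. of_int (cs i) * unit_root n (u * xs i)) = 0"
    using n_pos assms by (intro galois_conjugate_sum)
  then show ?thesis by (simp add: expand)
qed

text \<open>In the product of the conjugates under u and - u the factors e(u D) and e(- u D) cancel,
  and the linear factors pair up to squared chords.\<close>

lemma chord_conj:
  assumes "coprime u n"
  shows "chord_sq n (u * a) * chord_sq n (u * b) = chord_sq n (u * c) * chord_sq n (u * d)"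
proof -
  note 1 = rel_conj[OF assms] and 2 = rel_conj[of "- u"]
  have 3: "unit_root n (u * D) * unit_root n (- (u * D)) = 1"
    by (simp add: unit_root_uminus_inverse)
  have "coprime (- u) n" using assms by simp
  note 2 = 2[OF this, unfolded mult_minus_left]
  show ?thesis unfolding chord_sq_def using 1 2 3 by algebra
qed

lemma chord: "chord_sq n a * chord_sq n b = chord_sq n c * chord_sq n d"
  using chord_conj[of 1] by simp

text \<open>Once the products agree, expanding the complements 4 - X leaves just equality of the
  sums.\<close>

lemma chord_cases_if_complement:
  assumes "(4 - chord_sq n a) * (4 - chord_sq n b) = (4 - chord_sq n c) * (4 - chord_sq n d)"
  shows "chord_sq n a = chord_sq n c \<and> chord_sq n b = chord_sq n d \<or>
         chord_sq n a = chord_sq n d \<and> chord_sq n b = chord_sq n c"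
proof (rule equal_sum_prod_cases[OF chord])
  have "4 * (chord_sq n a + chord_sq n b) = 4 * (chord_sq n c + chord_sq n d)"
    using assms chord by algebra
  then show "chord_sq n a + chord_sq n b = chord_sq n c + chord_sq n d"
    by (metis mult_left_cancel zero_neq_numeral)
qed

text \<open>2 is a unit modulo n, and doubling multiplies every squared chord by its complement;
  cancelling the original relation leaves the complements.\<close>

lemma chord_cases_odd:
  assumes "odd n"
  shows "chord_sq n a = chord_sq n c \<and> chord_sq n b = chord_sq n d \<or>
         chord_sq n a = chord_sq n d \<and> chord_sq n b = chord_sq n c"
proof (rule chord_cases_if_complement)
  have "chord_sq n (2 * a) * chord_sq n (2 * b) = chord_sq n (2 * c) * chord_sq n (2 * d)"
    using assms by (intro chord_conj) simp
  then have "(chord_sq n a * chord_sq n b) * ((4 - chord_sq n a) * (4 - chord_sq n b)) =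
      (chord_sq n c * chord_sq n d) * ((4 - chord_sq n c) * (4 - chord_sq n d))"
    unfolding chord_sq_double by (simp only: mult_ac)
  with chord chord_nz show "(4 - chord_sq n a) * (4 - chord_sq n b) =
      (4 - chord_sq n c) * (4 - chord_sq n d)" by simp
qed

end

lemma unit_root_in_range:
  assumes "n > 0"
  shows "unit_root n x \<in> range (int_eval (unit_root n 1))"
proof
  have "unit_root n 1 ^ nat (x mod n) = unit_root n x"
    using assms by (simp add: unit_root_power unit_root_eq_iff mod_eq_dvd_iff[symmetric])
  then show "unit_root n x = int_eval (unit_root n 1) (monom 1 (nat (x mod n)))" by simp
qed simp

text \<open>The powers of z sum to zero, so N is the sum of the 1 - z^j, each a multiple of 1 - z in
  Z[e(1)].\<close>

lemma odd_order_dvd: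
  assumes n: "n > 0" and z: "unit_root n x ^ N = 1" "unit_root n x \<noteq> 1"
  shows "\<exists>G. (1 - unit_root n x) * int_eval (unit_root n 1) G = of_nat N"
proof -
  let ?z = "unit_root n x"
  obtain F where F: "?z = int_eval (unit_root n 1) F" using unit_root_in_range[OF n] by blast
  have "(\<Sum>j<N. ?z ^ j) = 0" using z by (simp add: sum_gp_strict)
  then have "of_nat N = (\<Sum>j<N. 1 - ?z ^ j)" by (simp add: sum_subtractf)
  also have "\<dots> = (\<Sum>j<N. (1 - ?z) * (\<Sum>i<j. ?z ^ i))" by (simp add: one_diff_power_eq)
  also have "\<dots> = (1 - ?z) * int_eval (unit_root n 1) (\<Sum>j<N. \<Sum>i<j. F ^ i)"
    by (simp add: F sum_distrib_left)
  finally show ?thesis by metis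
qed

section \<open>Orders divisible by four\<close>

text \<open>A substitute for having 2-adic valuation zero: being a factor, over \<open>\<int>[e(1)]\<close>, of an odd integer.\<close>

definition odd_multiple :: "int \<Rightarrow> complex \<Rightarrow> bool" where
  "odd_multiple n w \<longleftrightarrow> (\<exists>G M. odd M \<and> w * int_eval (unit_root n 1) G = of_int M)"

lemma odd_multiple_mult:
  assumes "odd_multiple n v" "odd_multiple n w"
  shows "odd_multiple n (v * w)"
proof -
  obtain G M H L where "odd M" "v * int_eval (unit_root n 1) G = of_int M"
    "odd L" "w * int_eval (unit_root n 1) H = of_int L"
    using assms unfolding odd_multiple_def by blast
  then have "odd (M * L)" "v * w * int_eval (unit_root n 1) (G * H) = of_int (M * L)"
    by (simp, simp add: mult.assoc mult.left_commute[of w])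
  then show ?thesis unfolding odd_multiple_def by blast
qed

lemma odd_multiple_cancel:
  assumes "odd_multiple n (v * int_eval (unit_root n 1) F)"
  shows "odd_multiple n v"
  using assms unfolding odd_multiple_def by (metis int_eval_mult mult.assoc)

lemma not_odd_multiple_2:
  assumes "n > 0"
  shows "\<not> odd_multiple n 2"
proof
  assume "odd_multiple n 2"
  then obtain G M where GM: "odd M" "2 * int_eval (unit_root n 1) G = of_int M"
    unfolding odd_multiple_def by blast
  have "unit_root n 1 ^ nat n = 1" using assms by (simp add: unit_root_power unit_root_eq_1_iff)
  then have "2 dvd M" using assms GM(2) by (intro int_eval_eq_int_dvd[of "unit_root n 1" "nat n" 2 G]) auto
  with GM(1) show False by simp
qed

lemma chord_sq_in_range:
  assumes "n > 0"
  shows "chord_sq n x \<in> range (int_eval (unit_root n 1))"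
proof -
  obtain F G where "unit_root n x = int_eval (unit_root n 1) F" "unit_root n (- x) = int_eval (unit_root n 1) G"
    using unit_root_in_range[OF assms] by blast
  then have "chord_sq n x = int_eval (unit_root n 1) ((F - 1) * (G - 1))"
    by (simp add: chord_sq_def)
  then show ?thesis by blast
qed

lemma not_odd_multiple_2_mult:
  assumes "n > 0" "w \<in> range (int_eval (unit_root n 1))"
  shows "\<not> odd_multiple n (2 * w)"
  using assms odd_multiple_cancel not_odd_multiple_2 by blast

lemma odd_multiple_odd_order:
  assumes n: "n > 0" and z: "unit_root n x ^ N = 1" "unit_root n x \<noteq> 1" "odd N"
  shows "odd_multiple n (1 - unit_root n x)"
  using odd_order_dvd[OF n z(1,2)] z(3) unfolding odd_multiple_def
  by (metis of_int_of_nat_eq even_of_nat)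

lemma odd_order_square:
  fixes z :: "'a :: comm_ring_1"
  assumes "z ^ N = 1" "odd N" "z ^ 2 = 1"
  shows "z = 1"
proof -
  obtain i where "N = 2 * i + 1" using assms(2) by (elim oddE)
  then show ?thesis using assms by (simp add: power_mult)
qed

text \<open>1 + z divides 1 - z^2, and z^2 is again a non-trivial root of odd order.\<close>

lemma odd_multiple_odd_order_plus:
  assumes n: "n > 0" and z: "unit_root n x ^ N = 1" "unit_root n x \<noteq> 1" "odd N"
  shows "odd_multiple n (1 + unit_root n x)"
proof -
  obtain F where F: "unit_root n x = int_eval (unit_root n 1) F" using unit_root_in_range[OF n] by blast
  have sq: "unit_root n (2 * x) = unit_root n x ^ 2" by (simp add: unit_root_power)
  have "unit_root n x ^ 2 \<noteq> 1" using odd_order_square[of "unit_root n x" N] z by blast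
  moreover have "(unit_root n x ^ 2) ^ N = 1" using z(1) by (metis power_mult mult.commute power_one)
  ultimately have "odd_multiple n (1 - unit_root n x ^ 2)"
    using odd_multiple_odd_order[OF n, of "2 * x" N] z(3) by (simp add: sq)
  also have "1 - unit_root n x ^ 2 = (1 + unit_root n x) * int_eval (unit_root n 1) (1 - F)"
    by (simp add: F[symmetric] algebra_simps power2_eq_square)
  finally show ?thesis by (rule odd_multiple_cancel)
qed

text \<open>For even x, e(x) has odd order up to sign: if 4 divides x, then e(x)^h = 1; otherwise x
  + 2 h is a multiple of 4 and e(x) = - e(x + 2 h). The value 4 belongs to e(x) = -1.\<close>

lemma odd_multiple_chord_sq:
  assumes n: "n = 4 * h" "h > 0" "odd h" and x: "even x" "\<not> n dvd x"
  shows "odd_multiple n (chord_sq n x) \<or> chord_sq n x = 4 \<and> \<not> 4 dvd x"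
proof (cases "4 dvd x")
  case True
  then obtain y where y: "x = 4 * y" by (elim dvdE)
  have n0: "n > 0" using n by simp
  have ord: "unit_root n (4 * y') ^ nat h = 1" for y'
    using n by (simp add: unit_root_power unit_root_eq_1_iff)
  have "odd (nat h)" using n by (simp add: even_nat_iff)
  then have "odd_multiple n (1 - unit_root n x)" "odd_multiple n (1 - unit_root n (- x))"
    using x(2) ord[of y] ord[of "-y"] n0 unfolding y
    by (auto intro!: odd_multiple_odd_order[of _ _ "nat h"] simp: unit_root_eq_1_iff)
  from odd_multiple_mult[OF this] have "odd_multiple n (chord_sq n x)"
    by (simp add: chord_sq_def algebra_simps)
  then show ?thesis ..
next
  case False
  have n0: "n > 0" using n by simp
  have "\<exists>y. x = 4 * y + 2" using x(1) False by presburger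
  then obtain y where y: "x = 4 * y + 2" by blast
  obtain i where i: "h = 2 * i + 1" using n(3) by (elim oddE)
  define z where "z = 4 * (y + i + 1)"
  have xz: "x = z - 2 * h" by (simp add: y z_def i)
  have "unit_root n (2 * h) = -1" using unit_root_half[of "2 * h"] n by simp
  then have ux: "unit_root n x = - unit_root n z" "unit_root n (- x) = - unit_root n (- z)"
    unfolding xz by (simp_all add: unit_root_diff unit_root_uminus_inverse divide_inverse)
  have ord: "unit_root n z ^ nat h = 1" "unit_root n (- z) ^ nat h = 1"
    using n by (simp_all add: unit_root_power unit_root_eq_1_iff z_def)
  have oh: "odd (nat h)" using n by (simp add: even_nat_iff)
  show ?thesis
  proof (cases "unit_root n z = 1")
    case True
    then show ?thesis using False by (simp add: chord_sq_def ux unit_root_uminus)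
  next
    case neq: False
    then have "unit_root n (- z) \<noteq> 1" by (simp add: unit_root_uminus_inverse)
    with neq have "odd_multiple n (1 + unit_root n z)" "odd_multiple n (1 + unit_root n (- z))"
      using odd_multiple_odd_order_plus[OF n0] ord oh by blast+
    from odd_multiple_mult[OF this] have "odd_multiple n (chord_sq n x)"
      by (simp add: chord_sq_def ux algebra_simps)
    then show ?thesis ..
  qed
qed

text \<open>A 2-adic contradiction. The value 2 means that e(x) is i or -i, which for odd x forces h
  to be odd. Then the squared chords of v, w and y divide odd integers, except that those of v and w
  may be 4; in every case the powers of 2 on the two sides do not match.\<close>

lemma single_odd_chord_contradiction:
  assumes n: "n = 4 * h" "h > 0" and x: "odd x" "chord_sq n x = 2"
    and y: "4 dvd y" "\<not> n dvd y" and v: "even v" "\<not> n dvd v" and w: "even w" "\<not> n dvd w"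
    and eq: "chord_sq n x * chord_sq n y = chord_sq n v * chord_sq n w"
  shows False
proof -
  have n0: "n > 0" using n by simp
  have "unit_root n x * unit_root n (- x) = 1" by (simp add: unit_root_uminus_inverse)
  moreover have "unit_root n x + unit_root n (- x) = 2 - chord_sq n x" by (simp add: chord_sq_altdef)
  ultimately have "unit_root n x * unit_root n x = - 1" unfolding x(2) by algebra
  moreover have "unit_root n (2 * h) = - 1" using unit_root_half[of "2 * h"] n by simp
  moreover have "unit_root n (2 * x) = unit_root n x * unit_root n x"
    by (simp add: power2_eq_square[symmetric] unit_root_power)
  ultimately have "unit_root n (2 * x - 2 * h) = 1"
    by (simp add: unit_root_diff)
  then have "4 * h dvd 2 * x - 2 * h" using n by (simp add: unit_root_eq_1_iff)
  then have "2 * (2 * h) dvd 2 * (x - h)" by (simp add: algebra_simps)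
  then have "2 * h dvd x - h" by (simp only: dvd_mult_cancel_left) simp
  then have "even (x - h)" by (metis dvd_mult_left)
  with x(1) have h: "odd h" by simp
  have oy: "odd_multiple n (chord_sq n y)"
    using odd_multiple_chord_sq[OF n h, of y] y by (metis dvd_trans[of 2 4 y] even_numeral)
  note ov = odd_multiple_chord_sq[OF n h v] and ow = odd_multiple_chord_sq[OF n h w]
  have no: "\<not> odd_multiple n (2 * chord_sq n u)" for u
    using not_odd_multiple_2_mult[OF n0 chord_sq_in_range[OF n0]] .
  have *: False if "chord_sq n v = 4 \<or> chord_sq n w = 4"
  proof -
    have "2 * chord_sq n y = 4 * chord_sq n w \<or> 2 * chord_sq n y = 4 * chord_sq n v"
      using that eq x(2) by auto
    then have "chord_sq n y = 2 * chord_sq n w \<or> chord_sq n y = 2 * chord_sq n v" by auto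
    with oy no show False by metis
  qed
  with ov ow have "odd_multiple n (chord_sq n v)" "odd_multiple n (chord_sq n w)" by auto
  then have "odd_multiple n (chord_sq n v * chord_sq n w)" by (rule odd_multiple_mult)
  then have "odd_multiple n (2 * chord_sq n y)" using eq x(2) by simp
  with no show False by blast
qed

text \<open>1 + 2 h is the exponent of e(1) |-> - e(1): it changes the sign of e(x) for odd x, and 2
  + e(x) + e(-x) is the complement to 4.\<close>

lemma half_turn_chord:
  assumes "n = 4 * h" "h > 0"
  shows "chord_sq n ((1 + 2 * h) * x) = (if even x then chord_sq n x else 4 - chord_sq n x)"
proof -
  have e: "unit_root n (2 * h * y) = (if even y then 1 else -1)" for y
    using unit_root_half_mult[of "2 * h" y] assms by simp
  have "unit_root n ((1 + 2 * h) * x) = unit_root n x * unit_root n (2 * h * x)"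
    "unit_root n (- ((1 + 2 * h) * x)) = unit_root n (- x) * unit_root n (2 * h * (- x))"
    by (simp_all add: algebra_simps flip: unit_root_add)
  then show ?thesis unfolding e by (simp add: chord_sq_altdef)
qed

context root_relation begin

text \<open>The conjugation complements exactly the chords of odd argument. If all four are odd, the
  complements have equal products; if one is odd on each side, these two chords agree; if just one
  is odd, it equals its own complement, so it is 2, which is excluded 2-adically.\<close>

lemma chord_cases_4_dvd:
  assumes n: "n = 4 * h" and abcd: "a = s * m" "b = t * k" "c = t * m" "d = s * k"
    and st: "odd s \<or> odd t" and mk: "odd m \<or> odd k"
  shows "chord_sq n a = chord_sq n c \<and> chord_sq n b = chord_sq n d \<or>
         chord_sq n a = chord_sq n d \<and> chord_sq n b = chord_sq n c"
proof -
  have h: "h > 0" using n n_pos by simp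
  have "coprime (1 + 2 * h) (2 * h)" using coprime_add_one_left[of "2 * h"] by (simp add: add.commute)
  then have "coprime (1 + 2 * h) (2 * (2 * h))"
    unfolding coprime_mult_right_iff by simp
  then have "coprime (1 + 2 * h) n" by (simp add: n)
  note conj = chord_conj[OF this, unfolded half_turn_chord[OF n h]]
  have even_nz: "4 dvd x * y" if "even x" "even y" for x y :: int
    using that mult_dvd_mono[of 2 x 2 y] by simp
  have two: "chord_sq n x = 2" if "4 - chord_sq n x = chord_sq n x" for x
    using that by (simp add: diff_eq_eq)
  consider "odd s" "odd t" "odd m" "odd k" | "odd s" "odd t" "odd m" "even k"
    | "odd s" "odd t" "even m" "odd k" | "odd s" "even t" "odd m" "odd k"
    | "even s" "odd t" "odd m" "odd k" | "odd s" "even t" "odd m" "even k"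
    | "odd s" "even t" "even m" "odd k" | "even s" "odd t" "odd m" "even k"
    | "even s" "odd t" "even m" "odd k"
    using st mk by (cases "odd s"; cases "odd t"; cases "odd m"; cases "odd k") simp_all
  then show ?thesis
  proof cases
    case 1
    then show ?thesis using conj abcd by (intro chord_cases_if_complement) auto
  next
    case 2
    then have "(4 - chord_sq n a) * chord_sq n b = (4 - chord_sq n c) * chord_sq n d"
      using conj abcd by simp
    then have "chord_sq n b = chord_sq n d" using chord by (simp add: algebra_simps)
    then show ?thesis using chord chord_nz by simp
  next
    case 3
    then have "chord_sq n a * (4 - chord_sq n b) = chord_sq n c * (4 - chord_sq n d)"
      using conj abcd by simp
    then have "chord_sq n a = chord_sq n c" using chord by (simp add: algebra_simps)
    then show ?thesis using chord chord_nz by simp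
  next
    case 4
    then have "(4 - chord_sq n a) * chord_sq n b = chord_sq n c * (4 - chord_sq n d)"
      using conj abcd by simp
    then have "chord_sq n b = chord_sq n c" using chord by (simp add: algebra_simps)
    then show ?thesis using chord chord_nz by simp
  next
    case 5
    then have "chord_sq n a * (4 - chord_sq n b) = (4 - chord_sq n c) * chord_sq n d"
      using conj abcd by simp
    then have "chord_sq n a = chord_sq n d" using chord by (simp add: algebra_simps)
    then show ?thesis using chord chord_nz by simp
  next
    case 6
    then have "(4 - chord_sq n a) * chord_sq n b = chord_sq n a * chord_sq n b"
      using conj abcd chord by simp
    then have "4 - chord_sq n a = chord_sq n a" using chord_nz by simp
    then have "chord_sq n a = 2" by (rule two)
    then have False using 6 abcd nz chord even_nz
      by (intro single_odd_chord_contradiction[OF n h, of a b c d]) auto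
    then show ?thesis ..
  next
    case 7
    then have "chord_sq n c * (4 - chord_sq n d) = chord_sq n c * chord_sq n d"
      using conj abcd chord by simp
    then have "4 - chord_sq n d = chord_sq n d" using chord_nz by simp
    then have "chord_sq n d = 2" by (rule two)
    then have False using 7 abcd nz chord even_nz
      by (intro single_odd_chord_contradiction[OF n h, of d c a b]) (auto simp: mult.commute)
    then show ?thesis ..
  next
    case 8
    then have "(4 - chord_sq n c) * chord_sq n d = chord_sq n c * chord_sq n d"
      using conj abcd chord by simp
    then have "4 - chord_sq n c = chord_sq n c" using chord_nz by simp
    then have "chord_sq n c = 2" by (rule two)
    then have False using 8 abcd nz chord even_nz
      by (intro single_odd_chord_contradiction[OF n h, of c d a b]) auto
    then show ?thesis ..
  next
    case 9
    then have "chord_sq n a * (4 - chord_sq n b) = chord_sq n a * chord_sq n b"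
      using conj abcd chord by simp
    then have "4 - chord_sq n b = chord_sq n b" using chord_nz by simp
    then have "chord_sq n b = 2" by (rule two)
    then have False using 9 abcd nz chord even_nz
      by (intro single_odd_chord_contradiction[OF n h, of b a c d]) (auto simp: mult.commute)
    then show ?thesis ..
  qed
qed

end

section \<open>Twice an odd order\<close>

text \<open>The third power sum is absent because iterated squaring provides only the exponents 1, 2
  and 4.\<close>

lemma newton_power_sum_4:
  fixes g1 g2 g3 g4 :: "'a :: comm_ring_1"
  defines "e1 \<equiv> g1 + g2 + g3 + g4"
    and "e2 \<equiv> g1 * g2 + g1 * g3 + g1 * g4 + g2 * g3 + g2 * g4 + g3 * g4"
    and "e3 \<equiv> g1 * g2 * g3 + g1 * g2 * g4 + g1 * g3 * g4 + g2 * g3 * g4"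
    and "e4 \<equiv> g1 * g2 * g3 * g4"
  shows "g1^2 + g2^2 + g3^2 + g4^2 = e1^2 - 2 * e2"
    and "g1^4 + g2^4 + g3^4 + g4^4 = e1^4 - 4 * e1^2 * e2 + 2 * e2^2 + 4 * e1 * e3 - 4 * e4"
  unfolding e1_def e2_def e3_def e4_def by (simp_all add: algebra_simps power2_eq_square power4_eq_xxxx)

text \<open>By Newton's identities the three conditions on power sums determine enough of the elementary
  symmetric functions \<open>e1, \<dots>, e4\<close>: unless \<open>e4 = 1\<close>, they force \<open>e2 = 0\<close>, \<open>e3 = e1 e4\<close> and
  \<open>e1 = 1\<close>, so that the \<open>g\<close>s are the roots of \<open>(X - 1) (X ^ 3 - e4)\<close>.\<close>

lemma inversion_invariant_power_sums_cases:
  fixes g1 g2 g3 g4 :: "'a :: field_char_0"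
  assumes nz: "g1 \<noteq> 0" "g2 \<noteq> 0" "g3 \<noteq> 0" "g4 \<noteq> 0"
    and inv: "\<And>j. j \<in> {1, 2, 4} \<Longrightarrow> g1 ^ j + g2 ^ j + g3 ^ j + g4 ^ j =
       inverse g1 ^ j + inverse g2 ^ j + inverse g3 ^ j + inverse g4 ^ j"
    and neg: "g1 \<noteq> -1" "g2 \<noteq> -1" "g3 \<noteq> -1" "g4 \<noteq> -1" "g1 * g2 * g3 * g4 \<noteq> -1"
  shows "g1 * g2 * g3 * g4 = 1 \<or> g1 = 1 \<and> g2^3 = g3^3 \<and> g3^3 = g4^3
    \<or> g2 = 1 \<and> g1^3 = g3^3 \<and> g3^3 = g4^3 \<or> g3 = 1 \<and> g1^3 = g2^3 \<and> g2^3 = g4^3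
    \<or> g4 = 1 \<and> g1^3 = g2^3 \<and> g2^3 = g3^3"
proof (subst disj_imp, rule impI)
  assume ne1: "g1 * g2 * g3 * g4 \<noteq> 1"
  define e1 e2 e3 e4 where e: "e1 = g1 + g2 + g3 + g4"
    "e2 = g1 * g2 + g1 * g3 + g1 * g4 + g2 * g3 + g2 * g4 + g3 * g4"
    "e3 = g1 * g2 * g3 + g1 * g2 * g4 + g1 * g3 * g4 + g2 * g3 * g4"
    "e4 = g1 * g2 * g3 * g4"
  define i1 i2 i3 i4 where i: "i1 = inverse g1" "i2 = inverse g2" "i3 = inverse g3" "i4 = inverse g4"
  \<comment> \<open>Passing to inverses reverses the elementary symmetric functions, up to division
    by \<open>e4\<close>.\<close>
  define f1 f2 f3 f4 where f: "f1 = i1 + i2 + i3 + i4"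
    "f2 = i1 * i2 + i1 * i3 + i1 * i4 + i2 * i3 + i2 * i4 + i3 * i4"
    "f3 = i1 * i2 * i3 + i1 * i2 * i4 + i1 * i3 * i4 + i2 * i3 * i4"
    "f4 = i1 * i2 * i3 * i4"
  have f1: "f1 * e4 = e3" and f2: "f2 * e4 = e2" and f3: "f3 * e4 = e1" and f4: "f4 * e4 = 1"
    unfolding e f i using nz by (simp_all add: field_simps)
  have ef1: "e1 = f1" using inv[of 1] by (simp add: e f i)
  have "e1^2 - 2 * e2 = f1^2 - 2 * f2"
    using inv[of 2] newton_power_sum_4(1)[of g1 g2 g3 g4] newton_power_sum_4(1)[of i1 i2 i3 i4]
    by (simp add: e f i)
  then have ef2: "e2 = f2" using ef1 by simp
  have e4: "e4 \<noteq> 1" "e4 \<noteq> -1" "e4 \<noteq> 0" using ne1 neg nz by (simp_all add: e)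
  have "e2 * (e4 - 1) = 0" using f2 ef2 by (simp add: algebra_simps)
  then have e2: "e2 = 0" using e4 by simp
  have e3: "e3 = e1 * e4" using f1 ef1 by simp
  have "e1^4 - 4 * e1^2 * e2 + 2 * e2^2 + 4 * e1 * e3 - 4 * e4 =
     f1^4 - 4 * f1^2 * f2 + 2 * f2^2 + 4 * f1 * f3 - 4 * f4"
    using inv[of 4] newton_power_sum_4(2)[of g1 g2 g3 g4] newton_power_sum_4(2)[of i1 i2 i3 i4]
    by (simp add: e f i)
  then have "4 * (e1 * e3 - e4) = 4 * (e1 * f3 - f4)" using ef1 ef2 e2 by (simp add: algebra_simps)
  then have "e1 * e3 - e4 = e1 * f3 - f4" by (metis mult_left_cancel zero_neq_numeral)
  then have "(e1 * e3 - e4) * e4 = (e1 * f3 - f4) * e4" by simp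
  also have "\<dots> = e1 * (f3 * e4) - f4 * e4" by (simp add: algebra_simps)
  finally have "(e1 * e3 - e4) * e4 = e1 * (f3 * e4) - f4 * e4" .
  then have "(e1 * (e1 * e4) - e4) * e4 = e1 * e1 - 1" by (simp add: f3 f4 e3)
  then have "(e1^2 - 1) * ((e4 - 1) * (e4 + 1)) = 0" by algebra
  then have "e1^2 = 1" using e4 eq_neg_iff_add_eq_0[of e4 1] by simp
  moreover have "e1 \<noteq> -1"
  proof
    assume "e1 = -1"
    \<comment> \<open>The product is 1 + e1 + e2 + e3 + e4, where e2 = 0 and e3 = e1 * e4 = -
      e4.\<close>
    then have "(1 + g1) * (1 + g2) * (1 + g3) * (1 + g4) = 0"
      using e2 e3 unfolding e by algebra
    then show False using neg by (auto simp: add_eq_0_iff)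
  qed
  ultimately have e1: "e1 = 1" by (auto simp: power2_eq_1_iff)
  then have "(1 - g1) * (1 - g2) * (1 - g3) * (1 - g4) = 0"
    using e2 e3 unfolding e by algebra
  then have "g1 = 1 \<or> g2 = 1 \<or> g3 = 1 \<or> g4 = 1" by auto
  \<comment> \<open>Such u, v, w are the roots of X^3 - u v w.\<close>
  moreover have cubes: "u^3 = v^3 \<and> v^3 = w^3"
    if "u + v + w = 0" "u * v + u * w + v * w = 0" for u v w :: 'a
    using that by algebra
  have "g2^3 = g3^3 \<and> g3^3 = g4^3" if "g1 = 1"
    using that e1 e2 unfolding e by - (rule cubes; algebra)
  moreover have "g1^3 = g3^3 \<and> g3^3 = g4^3" if "g2 = 1"
    using that e1 e2 unfolding e by - (rule cubes; algebra)
  moreover have "g1^3 = g2^3 \<and> g2^3 = g4^3" if "g3 = 1"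
    using that e1 e2 unfolding e by - (rule cubes; algebra)
  moreover have "g1^3 = g2^3 \<and> g2^3 = g3^3" if "g4 = 1"
    using that e1 e2 unfolding e by - (rule cubes; algebra)
  ultimately show "g1 = 1 \<and> g2^3 = g3^3 \<and> g3^3 = g4^3
    \<or> g2 = 1 \<and> g1^3 = g3^3 \<and> g3^3 = g4^3 \<or> g3 = 1 \<and> g1^3 = g2^3 \<and> g2^3 = g4^3
    \<or> g4 = 1 \<and> g1^3 = g2^3 \<and> g2^3 = g3^3" by blast
qed

text \<open>A prime q of h divides every w with h dvd 3 * w exactly if it divides h / gcd h 3. With
  all such primes excluded, this quotient is 1, so h divides 3.\<close>

lemma eq_1_or_3_if_prime_condition:
  fixes h :: int
  assumes "h > 0" and "\<And>q. prime q \<Longrightarrow> q dvd h \<Longrightarrow> (\<And>w. h dvd 3 * w \<Longrightarrow> q dvd w) \<Longrightarrow> False"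
  shows "h = 1 \<or> h = 3"
proof (subst disj_imp, rule impI)
  assume "h \<noteq> 1"
  then obtain q where q: "prime q" "q dvd h" using assms(1) prime_divisor_exists[of h] by auto
  have q3: "q = 3"
  proof (rule ccontr)
    assume "q \<noteq> 3"
    have "\<not> q dvd 3"
    proof
      assume "q dvd 3"
      then have "q \<le> 3" by (rule zdvd_imp_le) simp
      with prime_ge_2_int[OF q(1)] \<open>q \<noteq> 3\<close> have "q = 2" by simp
      with \<open>q dvd 3\<close> show False by simp
    qed
    then show False using assms(2)[OF q] q by (metis dvd_trans prime_dvd_mult_iff)
  qed
  then obtain r where r: "h = 3 * r" using q by (auto elim: dvdE)
  show "h = 3"
  proof (cases "r = 1")
    case False
    then obtain q' where q': "prime q'" "q' dvd r" using assms(1) r prime_divisor_exists[of r] by auto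
    have "q' dvd w" if "h dvd 3 * w" for w using that q' unfolding r by (auto intro: dvd_trans)
    then have False using assms(2)[of q'] q' r by auto
    then show ?thesis ..
  qed (use r in simp)
qed

text \<open>For odd \<open>h\<close>, every \<open>2 h\<close>-th root of unity is up to sign a root of odd order; \<open>odd_part h x\<close> is the
  one belonging to \<open>e(x)\<close>, the sign being the parity of \<open>x\<close>.\<close>

definition odd_part :: "int \<Rightarrow> int \<Rightarrow> complex" where
  "odd_part h x = unit_root (2 * h) ((h + 1) * x)"

text \<open>\<open>e(u x) - 1\<close>, for the automorphism \<open>u\<close> that acts on odd-order roots as raising to the power \<open>2 N\<close>,
  divided by the root of unity that makes it real or purely imaginary.\<close>

definition sym_chord :: "int \<Rightarrow> nat \<Rightarrow> int \<Rightarrow> complex" where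
  "sym_chord h N x =
     (if even x then odd_part h x ^ N - inverse (odd_part h x ^ N)
      else - (odd_part h x ^ N + inverse (odd_part h x ^ N)))"

lemma odd_part_add: "odd_part h (x + y) = odd_part h x * odd_part h y"
  by (simp add: odd_part_def distrib_left unit_root_add)

lemma odd_part_uminus: "odd_part h (- x) = inverse (odd_part h x)"
  by (simp add: odd_part_def unit_root_uminus_inverse)

lemma odd_part_diff: "odd_part h (x - y) = odd_part h x * inverse (odd_part h y)"
  using odd_part_add[of h x "-y"] by (simp add: odd_part_uminus)

lemma cnj_odd_part: "cnj (odd_part h x) = inverse (odd_part h x)"
  by (simp add: odd_part_def unit_root_uminus_inverse flip: unit_root_uminus)

lemma odd_part_nz [simp]: "odd_part h x \<noteq> 0"
  by (simp add: odd_part_def)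

lemma odd_part_power: "odd_part h x ^ N = odd_part h (int N * x)"
  by (simp add: odd_part_def unit_root_power mult_ac)

context
  fixes h :: int
  assumes h: "h > 0" "odd h"
begin

lemma odd_part_order: "odd_part h x ^ nat h = 1"
proof -
  obtain i where "h = 2 * i + 1" using h(2) by (elim oddE)
  then have "h * ((h + 1) * x) = 2 * h * ((i + 1) * x)" by (simp add: algebra_simps)
  then show ?thesis using h by (simp add: odd_part_def unit_root_power unit_root_eq_1_iff)
qed

lemma odd_part_eq_1: "odd_part h x = 1 \<Longrightarrow> h dvd x"
proof -
  assume "odd_part h x = 1"
  then have "h dvd h * x + x" using h
    by (simp add: odd_part_def unit_root_eq_1_iff distrib_right) (metis dvd_mult_right)
  then show ?thesis by (simp add: dvd_add_right_iff)
qed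

lemma odd_part_neq_minus_1: "odd_part h x \<noteq> -1"
proof
  assume *: "odd_part h x = -1"
  have "(-1 :: complex) ^ nat h = -1" using h by (simp add: even_nat_iff)
  with odd_part_order[of x] show False by (simp add: *)
qed

lemma odd_part_cube_eq: "odd_part h x ^ 3 = odd_part h y ^ 3 \<Longrightarrow> h dvd 3 * (x - y)"
proof -
  assume "odd_part h x ^ 3 = odd_part h y ^ 3"
  then have "odd_part h (3 * (x - y)) = 1"
    by (simp add: odd_part_power odd_part_diff right_diff_distrib)
  then show ?thesis by (rule odd_part_eq_1)
qed

lemma unit_root_odd_part: "unit_root (2 * h) x = (if even x then 1 else -1) * odd_part h x"
proof -
  have "odd_part h x = unit_root (2 * h) (h * x) * unit_root (2 * h) x"
    by (simp add: odd_part_def distrib_right unit_root_add)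
  then show ?thesis using h by (simp add: unit_root_half_mult)
qed

text \<open>2 N + h is odd, so it preserves the sign, and it is 2 N modulo h. The even exponent has
  a half, which \<open>unit_root_conj_sym_chord\<close> pulls out to make the rest symmetric under
  inversion up to sign.\<close>

lemma unit_root_conj_odd_part:
  "unit_root (2 * h) ((2 * N + h) * x) = (if even x then 1 else -1) * (odd_part h x ^ nat N)^2"
  if "N \<ge> 0"
proof -
  have "(odd_part h x ^ nat N)^2 = unit_root (2 * h) (2 * N * ((h + 1) * x))"
    using that by (simp add: odd_part_def unit_root_power mult_ac)
  also have "\<dots> = unit_root (2 * h) (2 * N * x) * unit_root (2 * h) (2 * h * (N * x))"
    by (simp add: algebra_simps flip: unit_root_add)
  also have "unit_root (2 * h) (2 * h * (N * x)) = 1" using h by (simp add: unit_root_eq_1_iff)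
  finally show ?thesis using h
    by (simp add: distrib_right unit_root_add unit_root_half_mult)
qed

lemma unit_root_conj_sym_chord:
  assumes "N \<ge> 0"
  shows "unit_root (2 * h) ((2 * N + h) * x) - 1 = odd_part h x ^ nat N * sym_chord h (nat N) x"
  unfolding unit_root_conj_odd_part[OF assms]
  by (simp add: sym_chord_def algebra_simps power2_eq_square)

lemma cnj_sym_chord: "cnj (sym_chord h N x) = (if even x then -1 else 1) * sym_chord h N x"
  by (simp add: sym_chord_def cnj_odd_part power_inverse)

lemma chord_sq_even_cong:
  assumes "even x" "even y" "h dvd x - y \<or> h dvd x + y"
  shows "chord_sq (2 * h) x = chord_sq (2 * h) y"
proof -
  have "2 * h dvd z" if "even z" "h dvd z" for z
    using that h by (intro divides_mult) simp_all
  from this[of "x - y"] this[of "x + y"] show ?thesis using assms h by (auto simp: chord_sq_eq_iff)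
qed

text \<open>The cases other than \<open>h dvd 2 * (y - v)\<close> come from \<open>sin x + sin (x + 2 \<pi> / 3) + sin (x + 4 \<pi> / 3) = 0\<close>;
  they are excluded by looking at the prime divisors of \<open>h\<close>.\<close>

lemma mixed_parity_chords:
  assumes par: "odd x" "even y" "odd z" "even v"
    and nd: "\<not> 2 * h dvd y" "\<not> 2 * h dvd v"
    and dvd: "\<And>q. q dvd x * y \<longleftrightarrow> q dvd z * v"
    and cop: "\<And>q. prime q \<Longrightarrow> q dvd h \<Longrightarrow> q dvd x \<Longrightarrow> q dvd y \<Longrightarrow> q dvd z \<Longrightarrow> q dvd v \<Longrightarrow> False"
    and eq: "\<And>N. N \<in> {1, 2, 4} \<Longrightarrow> sym_chord h N x * sym_chord h N y = sym_chord h N z * sym_chord h N v"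
  shows "chord_sq (2 * h) y = chord_sq (2 * h) v"
proof -
  \<comment> \<open>Product-to-sum: each side expands into roots minus their inverses, at sums and
    differences of the arguments. With the right side moved over, the relation says that the odd
    parts at the \<open>w\<close>s have the same power sums as their inverses.\<close>
  define w1 w2 w3 w4 where w: "w1 = x + y" "w2 = y - x" "w3 = - (z + v)" "w4 = z - v"
  have "odd_part h w1 ^ N + odd_part h w2 ^ N + odd_part h w3 ^ N + odd_part h w4 ^ N =
    inverse (odd_part h w1) ^ N + inverse (odd_part h w2) ^ N + inverse (odd_part h w3) ^ N
     + inverse (odd_part h w4) ^ N" if "N \<in> {1, 2, 4}" for N
    using eq[OF that] par unfolding w sym_chord_def
    by (simp add: odd_part_add odd_part_diff odd_part_uminus power_mult_distrib
        power_inverse algebra_simps)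
  note inv = this
  have prod: "odd_part h w1 * odd_part h w2 * odd_part h w3 * odd_part h w4 = odd_part h (2 * (y - v))"
    by (simp add: w flip: odd_part_add)
  have hodd: "h dvd u" if "h dvd 2 * u" for u
    using that h coprime_dvd_mult_right_iff[of h 2 u] by simp
  have "odd_part h (2 * (y - v)) = 1 \<or>
     odd_part h w1 = 1 \<and> odd_part h w2 ^ 3 = odd_part h w3 ^ 3 \<and> odd_part h w3 ^ 3 = odd_part h w4 ^ 3 \<or>
     odd_part h w2 = 1 \<and> odd_part h w1 ^ 3 = odd_part h w3 ^ 3 \<and> odd_part h w3 ^ 3 = odd_part h w4 ^ 3 \<or>
     odd_part h w3 = 1 \<and> odd_part h w1 ^ 3 = odd_part h w2 ^ 3 \<and> odd_part h w2 ^ 3 = odd_part h w4 ^ 3 \<or>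
     odd_part h w4 = 1 \<and> odd_part h w1 ^ 3 = odd_part h w2 ^ 3 \<and> odd_part h w2 ^ 3 = odd_part h w3 ^ 3"
    using inversion_invariant_power_sums_cases[OF odd_part_nz odd_part_nz odd_part_nz odd_part_nz inv
      odd_part_neq_minus_1 odd_part_neq_minus_1 odd_part_neq_minus_1 odd_part_neq_minus_1]
    unfolding prod using odd_part_neq_minus_1 by blast
  then have "h dvd 2 * (y - v) \<or>
      h dvd w1 \<and> h dvd 3 * (w2 - w3) \<and> h dvd 3 * (w3 - w4) \<or>
      h dvd w2 \<and> h dvd 3 * (w1 - w3) \<and> h dvd 3 * (w3 - w4) \<or>
      h dvd w3 \<and> h dvd 3 * (w1 - w2) \<and> h dvd 3 * (w2 - w4) \<or>
      h dvd w4 \<and> h dvd 3 * (w1 - w2) \<and> h dvd 3 * (w2 - w3)" (is "_ \<or> ?sporadic")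
    by - (elim disj_forward conj_forward; (rule odd_part_eq_1 odd_part_cube_eq; assumption))
  then show ?thesis
  proof
    assume "h dvd 2 * (y - v)"
    then have "h dvd y - v" by (rule hodd)
    then show ?thesis using par by (intro chord_sq_even_cong) auto
  next
    assume sp: ?sporadic
    \<comment> \<open>In a sporadic case, a prime dividing h / gcd h 3 divides one of the
      \<open>w\<close>s and the listed differences of the others; together with \<open>dvd\<close>
      this makes it divide x, y, z and v, against \<open>cop\<close>.\<close>
    have "h = 1 \<or> h = 3"
    proof (rule eq_1_or_3_if_prime_condition[OF h(1)])
      fix q :: int
      assume q: "prime q" "q dvd h" and q3: "\<And>w. h dvd 3 * w \<Longrightarrow> q dvd w"
      have q2: "q dvd u" if "q dvd 2 * u" for u
      proof -
        have "odd q" using q h by (metis dvd_trans)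
        then have "coprime q 2" by simp
        then show ?thesis using that coprime_dvd_mult_right_iff by blast
      qed
      have qh: "q dvd u" if "h dvd u" for u using that q(2) by (rule dvd_trans[rotated])
      have pm: "q dvd u \<and> q dvd u'" if "q dvd u * u'" "q dvd u + u' \<or> q dvd u' - u" for u u'
      proof -
        have "q dvd u \<longleftrightarrow> q dvd u'"
          using that(2) by (metis dvd_add_left_iff dvd_add_right_iff dvd_diff_commute diff_add_cancel)
        moreover have "q dvd u \<or> q dvd u'" using that(1) q(1) by (simp add: prime_dvd_mult_iff)
        ultimately show ?thesis by blast
      qed
      from sp have "q dvd w1 \<and> q dvd w2 - w3 \<and> q dvd w3 - w4 \<or>
        q dvd w2 \<and> q dvd w1 - w3 \<and> q dvd w3 - w4 \<or>
        q dvd w3 \<and> q dvd w1 - w2 \<and> q dvd w2 - w4 \<or>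
        q dvd w4 \<and> q dvd w1 - w2 \<and> q dvd w2 - w3"
        by (elim disjE conjE) (simp_all add: q3 qh)
      moreover have "q dvd x \<and> q dvd y \<and> q dvd z \<and> q dvd v" if "q dvd w1 \<and> q dvd w2 - w3 \<and> q dvd w3 - w4"
      proof -
        have "2 * z = - (w3 - w4)" by (simp add: w)
        then have "q dvd 2 * z" using that by (metis dvd_minus_iff)
        then have z: "q dvd z" by (rule q2)
        then have "q dvd x \<and> q dvd y" using that dvd[of q] by (intro pm) (simp_all add: w)
        moreover from this z that have "q dvd (w2 - w3) - y + x - z" by simp
        ultimately show ?thesis using z by (simp add: w)
      qed
      moreover have "q dvd x \<and> q dvd y \<and> q dvd z \<and> q dvd v" if "q dvd w2 \<and> q dvd w1 - w3 \<and> q dvd w3 - w4"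
      proof -
        have "2 * z = - (w3 - w4)" by (simp add: w)
        then have "q dvd 2 * z" using that by (metis dvd_minus_iff)
        then have z: "q dvd z" by (rule q2)
        then have "q dvd x \<and> q dvd y" using that dvd[of q] by (intro pm) (simp_all add: w)
        moreover from this z that have "q dvd (w1 - w3) - y - x - z" by simp
        ultimately show ?thesis using z by (simp add: w)
      qed
      moreover have "q dvd x \<and> q dvd y \<and> q dvd z \<and> q dvd v" if "q dvd w3 \<and> q dvd w1 - w2 \<and> q dvd w2 - w4"
      proof -
        have "2 * x = w1 - w2" by (simp add: w)
        then have "q dvd 2 * x" using that by metis
        then have x: "q dvd x" by (rule q2)
        have "q dvd - w3" using that by simp
        then have "q dvd z + v" by (simp add: w add.commute)
        then have "q dvd z \<and> q dvd v" using x dvd[of q] by (intro pm) simp_all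
        moreover from this x that have "q dvd (w2 - w4) + x + z - v" by simp
        ultimately show ?thesis using x by (simp add: w)
      qed
      moreover have "q dvd x \<and> q dvd y \<and> q dvd z \<and> q dvd v" if "q dvd w4 \<and> q dvd w1 - w2 \<and> q dvd w2 - w3"
      proof -
        have "2 * x = w1 - w2" by (simp add: w)
        then have "q dvd 2 * x" using that by metis
        then have x: "q dvd x" by (rule q2)
        have "q dvd - w4" using that by simp
        then have "q dvd v - z" by (simp add: w)
        then have "q dvd z \<and> q dvd v" using x dvd[of q] by (intro pm) simp_all
        moreover from this x that have "q dvd (w2 - w3) + x - z - v" by simp
        ultimately show ?thesis using x by (simp add: w)
      qed
      ultimately have "q dvd x \<and> q dvd y \<and> q dvd z \<and> q dvd v" by blast
      then show False using cop q by blast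
    qed
    then show ?thesis
    proof
      assume "h = 1"
      then show ?thesis using nd par by simp
    next
      assume h3: "h = 3"
      have "\<not> 3 dvd y" "\<not> 3 dvd v" using nd par unfolding h3 by presburger+
      then have "3 dvd y - v \<or> 3 dvd y + v" by presburger
      then show ?thesis using par h3 by (intro chord_sq_even_cong) simp_all
    qed
  qed
qed

end

lemma chord_sq_odd_part:
  assumes "h > 0" "odd h"
  shows "chord_sq (2 * h) x = 2 - (if even x then 1 else -1) * (odd_part h x + inverse (odd_part h x))"
  using unit_root_odd_part[OF assms, of x] unit_root_odd_part[OF assms, of "- x"]
  by (simp add: chord_sq_altdef odd_part_uminus)

context root_relation begin

context
  fixes h :: int
  assumes n2: "n = 2 * h" and h: "h > 0" "odd h"
begin

text \<open>\<open>T\<close> gathers the roots of unity stripped off the four factors together with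
  the odd part of the conjugate of e(D), of which only the sign remains outside.\<close>

lemma sym_chord_relation:
  assumes "N > 0"
  defines "T \<equiv> odd_part h (int N * (2 * D + a + b - c - d))"
  assumes cop: "coprime (2 * int N + h) (2 * h)"
  shows "(if even D then 1 else -1) * (T * (sym_chord h N a * sym_chord h N b)) =
         sym_chord h N c * sym_chord h N d"
    and "sym_chord h N c * sym_chord h N d \<noteq> 0"
proof -
  define y where "y x = odd_part h x ^ N" for x
  have y0: "y x \<noteq> 0" for x by (simp add: y_def)
  have cop': "coprime (2 * int N + h) n" using cop by (simp add: n2)
  have ur: "unit_root n ((2 * int N + h) * x) - 1 = y x * sym_chord h N x" for x
    using unit_root_conj_sym_chord[OF h, of "int N" x] by (simp add: n2 y_def)
  have uD: "unit_root n ((2 * int N + h) * D) = (if even D then 1 else -1) * (y D)^2"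
    using unit_root_conj_odd_part[OF h, of "int N" D] by (simp add: n2 y_def)
  have T: "T = (y D)^2 * y a * y b * inverse (y c) * inverse (y d)"
  proof -
    have D2: "odd_part h (2 * D) = odd_part h D ^ 2" by (simp add: odd_part_power)
    have "T = odd_part h (2 * D + a + b - c - d) ^ N" by (simp add: T_def odd_part_power)
    then show ?thesis unfolding y_def odd_part_add odd_part_diff D2
      by (simp add: power_mult_distrib power_inverse power_commutes mult.commute[of N 2] flip: power_mult)
  qed
  have "(if even D then 1 else -1) * (y D)^2 * ((y a * sym_chord h N a) * (y b * sym_chord h N b)) =
     (y c * sym_chord h N c) * (y d * sym_chord h N d)"
    using rel_conj[OF cop'] unfolding ur uD .
  then show "(if even D then 1 else -1) * (T * (sym_chord h N a * sym_chord h N b)) =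
         sym_chord h N c * sym_chord h N d"
    using y0[of c] y0[of d] unfolding T by (simp add: field_simps)
  have "sym_chord h N x \<noteq> 0" if "\<not> n dvd x" for x
  proof -
    have "\<not> n dvd (2 * int N + h) * x"
      using that cop' coprime_dvd_mult_right_iff[of n "2 * int N + h" x] by (simp add: coprime_commute)
    then show ?thesis using ur[of x] n_pos by (auto simp: unit_root_eq_1_iff)
  qed
  then show "sym_chord h N c * sym_chord h N d \<noteq> 0" using nz by simp
qed

text \<open>Every \<open>sym_chord\<close> is real or purely imaginary, so comparison with the
  complex conjugate gives T^2 = 1 or T^2 = -1. As T has odd order, the latter is impossible, which
  is the parity statement, and the former gives T = 1.\<close>

lemma sym_chord_relation_sign:
  assumes "N > 0" and cop: "coprime (2 * int N + h) (2 * h)"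
  shows "even (a + b + c + d)"
    and "(if even D then 1 else -1) * (sym_chord h N a * sym_chord h N b) =
         sym_chord h N c * sym_chord h N d"
proof -
  define T where "T = odd_part h (int N * (2 * D + a + b - c - d))"
  define A where "A = sym_chord h N a * sym_chord h N b"
  define C where "C = sym_chord h N c * sym_chord h N d"
  define e where "e = (if even D then 1 else -1 :: complex)"
  define s where "s x = (if even x then -1 else 1 :: complex)" for x :: int
  note r = sym_chord_relation[OF assms, folded T_def]
  have eq: "e * (T * A) = C" and C0: "C \<noteq> 0" using r by (simp_all add: A_def C_def e_def)
  have e2: "e * e = 1" "cnj e = e" by (auto simp: e_def)
  have cA: "cnj A = s a * s b * A" and cC: "cnj C = s c * s d * C"
    by (simp_all add: A_def C_def cnj_sym_chord[OF h] s_def)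
  have T0: "T \<noteq> 0" by (simp add: T_def)
  have "cnj (e * (T * A)) = cnj C" using eq by simp
  then have "e * (inverse T * (s a * s b * A)) = s c * s d * C"
    by (simp add: cA cC e2 T_def cnj_odd_part)
  then have "e * (s a * s b * A) = s c * s d * C * T" using T0 by (simp add: field_simps)
  then have "e * (s a * s b * A) * T = s c * s d * C * T^2" by (simp add: power2_eq_square)
  then have "s a * s b * (e * (T * A)) = s c * s d * C * T^2" by (simp add: mult_ac)
  then have sT: "s a * s b = s c * s d * T^2" using C0 by (simp add: eq)
  have TN: "T ^ nat h = 1" unfolding T_def by (rule odd_part_order[OF h])
  have oh: "odd (nat h)" using h by (simp add: even_nat_iff)
  show ev: "even (a + b + c + d)"
  proof (rule ccontr)
    assume "odd (a + b + c + d)"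
    then have "s a * s b = - (s c * s d)" by (auto simp: s_def)
    then have "s c * s d * (T^2 + 1) = 0" using sT by (simp add: distrib_left)
    moreover have "s c * s d \<noteq> 0" by (simp add: s_def)
    ultimately have "T^2 = -1" by (simp add: eq_neg_iff_add_eq_0)
    then have "(T^2)^2 = 1" by simp
    moreover have "(T^2) ^ nat h = (T ^ nat h)^2" by (simp only: power_mult[symmetric] mult.commute)
    ultimately have "T^2 = 1" using TN oh odd_order_square[of "T^2" "nat h"] by simp
    with \<open>T^2 = -1\<close> show False by simp
  qed
  then have "s a * s b = s c * s d" by (auto simp: s_def)
  then have "T^2 = 1" using sT by (auto simp: s_def split: if_splits)
  then have "T = 1" using TN oh odd_order_square by blast
  then show "(if even D then 1 else -1) * (sym_chord h N a * sym_chord h N b) =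
         sym_chord h N c * sym_chord h N d" using eq by (simp add: A_def C_def e_def)
qed

lemma coprime_conj: "coprime (2 * 2 ^ j + h) (2 * h)"
proof -
  have "coprime (2 * 2 ^ j) h" using h by simp
  then have "coprime (2 * 2 ^ j + h) h" by (simp add: coprime_iff_gcd_eq_1)
  then show ?thesis using h by simp
qed

lemma sym_chord_relation_pow2:
  assumes "N \<in> {1, 2, 4}"
  shows "(if even D then 1 else -1) * (sym_chord h N a * sym_chord h N b) =
         sym_chord h N c * sym_chord h N d"
proof (rule sym_chord_relation_sign(2))
  show "N > 0" using assms by auto
  show "coprime (2 * int N + h) (2 * h)"
    using assms coprime_conj[of 0] coprime_conj[of 1] coprime_conj[of 2] by auto
qed

lemma even_sum: "even (a + b + c + d)"
  using sym_chord_relation_sign(1)[of 1] coprime_conj[of 0] by simp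

lemma sym_chord_uminus_even: "even x \<Longrightarrow> sym_chord h N (- x) = - sym_chord h N x"
  by (simp add: sym_chord_def odd_part_uminus power_inverse)

lemma chord_sq_uminus: "chord_sq m (- x) = chord_sq m x"
  by (simp add: chord_sq_def mult.commute)

text \<open>The factor -1 of an odd D is absorbed by passing from v to - v: \<open>sym_chord\<close>
  is an odd function on even arguments. This is why \<open>mixed_parity_chords\<close> compares only
  the divisors of x * y and z * v.\<close>

lemma mixed_parity_chords_sign:
  assumes par: "odd x" "even y" "odd z" "even v" and nd: "\<not> n dvd y" "\<not> n dvd v" and xyzv: "x * y = z * v"
    and cop: "\<And>q. prime q \<Longrightarrow> q dvd h \<Longrightarrow> q dvd x \<Longrightarrow> q dvd y \<Longrightarrow> q dvd z \<Longrightarrow> q dvd v \<Longrightarrow> False"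
    and eq: "\<And>N. N \<in> {1, 2, 4} \<Longrightarrow> (if even D then 1 else -1) * (sym_chord h N x * sym_chord h N y) =
       sym_chord h N z * sym_chord h N v"
  shows "chord_sq n y = chord_sq n v"
proof (cases "even D")
  case True
  show ?thesis unfolding n2
    by (rule mixed_parity_chords[OF h par(1-4)]) (use nd xyzv cop eq True in \<open>auto simp: n2\<close>)
next
  case False
  have "chord_sq n y = chord_sq n (- v)" unfolding n2
    by (rule mixed_parity_chords[OF h, of x y z "- v"])
      (use par nd xyzv cop eq False in \<open>auto simp: n2 sym_chord_uminus_even minus_equation_iff\<close>)
  then show ?thesis by (simp add: chord_sq_uminus)
qed

text \<open>\<open>even_sum\<close> leaves two situations: all arguments odd, or one odd and one
  even on each side. In the former, N = 1 turns each \<open>sym_chord\<close> into 2 - X, and the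
  parity of D fixes the sign; with A B = C D this again yields equal sums.\<close>

lemma chord_cases_2_odd:
  assumes abcd: "a = s * m" "b = t * k" "c = t * m" "d = s * k"
    and st: "gcd n (gcd s t) = 1" and mk: "gcd n (gcd m k) = 1"
    and D: "odd s \<Longrightarrow> odd t \<Longrightarrow> odd m \<Longrightarrow> odd k \<Longrightarrow> even D"
  shows "chord_sq n a = chord_sq n c \<and> chord_sq n b = chord_sq n d \<or>
         chord_sq n a = chord_sq n d \<and> chord_sq n b = chord_sq n c"
proof -
  have gst: False if "prime q" "q dvd n" "q dvd s" "q dvd t" for q
    using that st by (metis gcd_greatest not_prime_unit)
  have gmk: False if "prime q" "q dvd n" "q dvd m" "q dvd k" for q
    using that mk by (metis gcd_greatest not_prime_unit)
  have cop: False if "prime q" "q dvd h" "q dvd a" "q dvd b" "q dvd c" "q dvd d" for q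
    using that gst[of q] gmk[of q] by (auto simp: abcd n2 prime_dvd_mult_iff)
  have "odd s \<or> odd t" "odd m \<or> odd k" using gst[of 2] gmk[of 2] by (auto simp: n2)
  with even_sum consider "odd s" "odd t" "odd m" "odd k" | "odd s" "odd t" "odd m" "even k"
    | "odd s" "odd t" "even m" "odd k" | "odd s" "even t" "odd m" "odd k"
    | "even s" "odd t" "odd m" "odd k"
    unfolding abcd by (cases "odd s"; cases "odd t"; cases "odd m"; cases "odd k") simp_all
  then show ?thesis
  proof cases
    case 1
    then have "sym_chord h 1 a * sym_chord h 1 b = sym_chord h 1 c * sym_chord h 1 d"
      using sym_chord_relation_pow2[of 1] D by simp
    moreover have "sym_chord h 1 x = 2 - chord_sq n x" if "odd x" for x
      using that by (simp add: sym_chord_def n2 chord_sq_odd_part[OF h])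
    ultimately have "(2 - chord_sq n a) * (2 - chord_sq n b) = (2 - chord_sq n c) * (2 - chord_sq n d)"
      using 1 by (simp add: abcd)
    then have "(4 - chord_sq n a) * (4 - chord_sq n b) = (4 - chord_sq n c) * (4 - chord_sq n d)"
      using chord by algebra
    then show ?thesis by (rule chord_cases_if_complement)
  next
    case 2
    then have "chord_sq n b = chord_sq n d"
      using nz cop sym_chord_relation_pow2
      by (intro mixed_parity_chords_sign[of a b c d]) (auto simp: abcd)
    then show ?thesis using chord chord_nz by simp
  next
    case 3
    then have "chord_sq n a = chord_sq n c"
      using nz cop sym_chord_relation_pow2
      by (intro mixed_parity_chords_sign[of b a d c]) (auto simp: abcd mult_ac)
    then show ?thesis using chord chord_nz by simp
  next
    case 4
    then have "chord_sq n b = chord_sq n c"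
      using nz cop sym_chord_relation_pow2
      by (intro mixed_parity_chords_sign[of a b d c]) (auto simp: abcd mult_ac)
    then show ?thesis using chord chord_nz by simp
  next
    case 5
    then have "chord_sq n a = chord_sq n d"
      using nz cop sym_chord_relation_pow2
      by (intro mixed_parity_chords_sign[of b a c d]) (auto simp: abcd mult_ac)
    then show ?thesis using chord chord_nz by simp
  qed
qed

end

lemma chord_cases:
  assumes abcd: "a = s * m" "b = t * k" "c = t * m" "d = s * k"
    and st: "gcd n (gcd s t) = 1" and mk: "gcd n (gcd m k) = 1"
    and D: "odd s \<Longrightarrow> odd t \<Longrightarrow> odd m \<Longrightarrow> odd k \<Longrightarrow> even D"
  shows "chord_sq n a = chord_sq n c \<and> chord_sq n b = chord_sq n d \<or>
         chord_sq n a = chord_sq n d \<and> chord_sq n b = chord_sq n c"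
proof (cases "odd n")
  case True
  then show ?thesis by (rule chord_cases_odd)
next
  case False
  then obtain h where h: "n = 2 * h" by auto
  have h0: "h > 0" using n_pos h by simp
  show ?thesis
  proof (cases "odd h")
    case True
    then show ?thesis using chord_cases_2_odd[OF h h0 _ abcd st mk D] by blast
  next
    case False
    then obtain h' where "h = 2 * h'" by auto
    then have "n = 4 * h'" using h by simp
    moreover have "odd s \<or> odd t" using st h by (metis False dvd_refl dvd_triv_left gcd_greatest odd_one)
    moreover have "odd m \<or> odd k" using mk h by (metis False dvd_refl dvd_triv_left gcd_greatest odd_one)
    ultimately show ?thesis using abcd chord_cases_4_dvd by blast
  qed
qed

end

section \<open>Two frequencies\<close>

lemma dvd_if_dvd_mult_coprime:
  fixes n :: int
  assumes "n dvd x * m" "n dvd x * k" "gcd n (gcd m k) = 1"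
  shows "n dvd x"
proof -
  have "n dvd gcd (x * m) (x * k)" using assms by simp
  also have "gcd (x * m) (x * k) = \<bar>x\<bar> * gcd m k" by (simp add: gcd_mult_distrib_int abs_mult)
  finally have "n dvd \<bar>x\<bar> * gcd m k" .
  moreover have "coprime n (gcd m k)" using assms(3) by (simp add: coprime_iff_gcd_eq_1)
  ultimately show ?thesis by (simp add: coprime_dvd_mult_left_iff)
qed

text \<open>The factor 2 stems from 2 s = (s - t) + (s + t) and 2 t = (s + t) - (s - t): n divides s
  - t times gcd n m and s + t times gcd n k.\<close>

lemma dvd_twice_gcds_if_mixed:
  fixes n :: int
  assumes "n dvd (s - t) * m" "n dvd (s + t) * k" "gcd n (gcd s t) = 1"
  shows "n dvd 2 * gcd n k * gcd n m"
proof (rule dvd_if_dvd_mult_coprime)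
  have gcd: "n dvd x * gcd n y" if "n dvd x * y" for x y
  proof -
    have "n dvd gcd (x * n) (x * y)" using that by simp
    also have "gcd (x * n) (x * y) = \<bar>x * gcd n y\<bar>" by (simp add: gcd_mult_distrib_int abs_mult)
    finally show ?thesis by simp
  qed
  have 1: "n dvd (s - t) * gcd n m" "n dvd (s + t) * gcd n k" using assms gcd by blast+
  have "2 * gcd n k * gcd n m * s = (s - t) * gcd n m * gcd n k + (s + t) * gcd n k * gcd n m"
    by (simp add: algebra_simps)
  then show "n dvd 2 * gcd n k * gcd n m * s" using 1 by (metis dvd_add dvd_mult2)
  have "2 * gcd n k * gcd n m * t = (s + t) * gcd n k * gcd n m - (s - t) * gcd n m * gcd n k"
    by (simp add: algebra_simps)
  then show "n dvd 2 * gcd n k * gcd n m * t" using 1 by (metis dvd_diff dvd_mult2)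
qed (fact assms(3))

lemma unit_root_neq_minus_1:
  assumes "n > 0" "odd n"
  shows "unit_root n x \<noteq> -1"
proof
  assume *: "unit_root n x = -1"
  have "(-1 :: complex) ^ nat n = -1" using assms by (simp add: even_nat_iff)
  moreover have "unit_root n x ^ nat n = 1" using assms by (simp add: unit_root_power unit_root_eq_1_iff)
  ultimately show False by (simp add: *)
qed

definition on_spectrum :: "int \<Rightarrow> int \<Rightarrow> int \<Rightarrow> int \<Rightarrow> complex \<Rightarrow> int \<Rightarrow> bool" where
  "on_spectrum n m2 m k w s \<longleftrightarrow>
     unit_root n (s * m2) * (unit_root n (s * m) - 1) = w * (unit_root n (s * k) - 1)"

lemma on_spectrum_pair_coprime:
  assumes n: "n > 0" and st: "gcd n (gcd s t) = 1" and mk: "gcd n (gcd m k) = 1"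
    and w: "w \<noteq> 0" "norm w \<noteq> 1"
    and s: "on_spectrum n m2 m k w s" "\<not> n dvd s * k" and t: "on_spectrum n m2 m k w t" "\<not> n dvd t * k"
  shows "n dvd s - t \<or> n dvd s + t \<or> even n \<and> n dvd 2 * gcd n k * gcd n m"
proof -
  let ?E = "unit_root n"
  note Rs = s(1)[unfolded on_spectrum_def] and Rt = t(1)[unfolded on_spectrum_def]
  have Ks: "?E (s * k) \<noteq> 1" and Kt: "?E (t * k) \<noteq> 1" using s(2) t(2) n by (simp_all add: unit_root_eq_1_iff)
  have Ms: "?E (s * m) \<noteq> 1" using Rs w(1) Ks by auto
  have Mt: "?E (t * m) \<noteq> 1" using Rt w(1) Kt by auto
  have nsm: "\<not> n dvd s * m" "\<not> n dvd t * m" using Ms Mt n by (simp_all add: unit_root_eq_1_iff)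
  interpret root_relation n "s * m" "t * k" "t * m" "s * k" "(s - t) * m2"
  proof
    have "?E (t * m2) * (?E ((s - t) * m2) * ((?E (s * m) - 1) * (?E (t * k) - 1))) =
       ?E (s * m2) * (?E (s * m) - 1) * (?E (t * k) - 1)"
      by (simp add: left_diff_distrib unit_root_diff)
    also have "\<dots> = (?E (t * m2) * (?E (t * m) - 1)) * (?E (s * k) - 1)"
      unfolding Rs Rt by (simp add: mult_ac)
    finally show "?E ((s - t) * m2) * ((?E (s * m) - 1) * (?E (t * k) - 1)) =
        (?E (t * m) - 1) * (?E (s * k) - 1)" by simp
  qed (use n nsm s t in auto)
  have ns: "chord_sq n (s * m) \<noteq> chord_sq n (s * k)"
  proof
    assume "chord_sq n (s * m) = chord_sq n (s * k)"
    then have "norm (?E (s * m) - 1) = norm (?E (s * k) - 1)"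
      unfolding chord_sq_norm of_real_eq_iff by simp
    moreover have "norm (?E (s * m) - 1) = norm w * norm (?E (s * k) - 1)"
      using arg_cong[OF Rs, of norm] by (simp add: norm_mult)
    ultimately show False using w(2) Ks by simp
  qed
  \<comment> \<open>For odd s and t the exponent (s - t) * m2 is even, as \<open>chord_cases\<close>
    requires. The crossed alternative is excluded by \<open>ns\<close>, that is, by |w| \<noteq>
    1.\<close>
  have "chord_sq n (s * m) = chord_sq n (t * m) \<and> chord_sq n (t * k) = chord_sq n (s * k)"
    using chord_cases[OF refl refl refl refl st mk] ns by simp
  then have 1: "n dvd s * m - t * m \<or> n dvd s * m + t * m" and 2: "n dvd t * k - s * k \<or> n dvd t * k + s * k"
    by (simp_all add: chord_sq_eq_iff[OF n])
  have 1: "n dvd (s - t) * m \<or> n dvd (s + t) * m" using 1 by (simp add: algebra_simps)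
  have 2: "n dvd (s - t) * k \<or> n dvd (s + t) * k" using 2 dvd_minus_iff[of n "(s - t) * k"]
    by (simp add: algebra_simps)
  consider "n dvd (s - t) * m" "n dvd (s - t) * k" | "n dvd (s + t) * m" "n dvd (s + t) * k"
    | "n dvd (s - t) * m" "n dvd (s + t) * k" | "n dvd (s + t) * m" "n dvd (s - t) * k" using 1 2 by blast
  then show ?thesis
  proof cases
    case 1
    then show ?thesis using dvd_if_dvd_mult_coprime[OF 1 mk] by blast
  next
    case 2
    then show ?thesis using dvd_if_dvd_mult_coprime[OF 2 mk] by blast
  next
    case 3
    \<comment> \<open>Here e(s m) = e(t m) and e(s k) e(t k) = 1, so the quotient of the two
      spectral equations exhibits -1 as a power of e(1).\<close>
    have "even n"
    proof (rule ccontr)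
      assume odd: "odd n"
      have M: "?E (t * m) = ?E (s * m)" using 3(1) n by (simp add: unit_root_eq_iff left_diff_distrib dvd_diff_commute)
      have "?E ((s + t) * k) = 1" using 3(2) n by (simp add: unit_root_eq_1_iff)
      then have K: "?E (s * k) * ?E (t * k) = 1" by (simp add: distrib_right unit_root_add)
      have "(?E (t * m2) * ?E (s * k) + ?E (s * m2)) * (w * (?E (s * k) - 1)) = 0"
        using Rs Rt K unfolding M by algebra
      then have "?E (t * m2) * ?E (s * k) + ?E (s * m2) = 0" using w(1) Ks by simp
      then have "?E (t * m2) * ?E (s * k) = - ?E (s * m2)" by (simp add: eq_neg_iff_add_eq_0)
      then have "?E (t * m2 + s * k - s * m2) = -1" by (simp add: unit_root_add unit_root_diff)
      then show False using unit_root_neq_minus_1[OF n odd] by blast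
    qed
    then show ?thesis using dvd_twice_gcds_if_mixed[OF 3 st] by blast
  next
    case 4
    have "even n"
    proof (rule ccontr)
      assume odd: "odd n"
      have K: "?E (t * k) = ?E (s * k)" using 4(2) n by (simp add: unit_root_eq_iff left_diff_distrib dvd_diff_commute)
      have "?E ((s + t) * m) = 1" using 4(1) n by (simp add: unit_root_eq_1_iff)
      then have M: "?E (s * m) * ?E (t * m) = 1" by (simp add: distrib_right unit_root_add)
      have "(?E (s * m2) * ?E (s * m) + ?E (t * m2)) * (?E (s * m) - 1) = 0"
        using Rs Rt M unfolding K by algebra
      then have "?E (s * m2) * ?E (s * m) + ?E (t * m2) = 0" using Ms by simp
      then have "?E (s * m2) * ?E (s * m) = - ?E (t * m2)" by (simp add: eq_neg_iff_add_eq_0)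
      then have "?E (s * m2 + s * m - t * m2) = -1" by (simp add: unit_root_add unit_root_diff)
      then show False using unit_root_neq_minus_1[OF n odd] by blast
    qed
    moreover have "n dvd 2 * gcd n k * gcd n m"
      by (rule dvd_twice_gcds_if_mixed[of n s "- t"]) (use 4 st in simp_all)
    ultimately show ?thesis by blast
  qed
qed

text \<open>Dividing n, s and t by their gcd changes no root of unity and makes them coprime; the
  price is that gcd as a factor in the last alternative.\<close>

lemma on_spectrum_pair:
  assumes n: "n > 0" and mk: "gcd n (gcd m k) = 1"
    and w: "w \<noteq> 0" "norm w \<noteq> 1"
    and s: "on_spectrum n m2 m k w s" "\<not> n dvd s * k" and t: "on_spectrum n m2 m k w t" "\<not> n dvd t * k"
  shows "n dvd s - t \<or> n dvd s + t \<or>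
    even n \<and> n dvd gcd n (gcd s t) * (2 * gcd n k * gcd n m)"
proof -
  define d where "d = gcd n (gcd s t)"
  have d0: "d > 0" using n by (simp add: d_def)
  have "d dvd n" "d dvd s" "d dvd t" unfolding d_def by (metis gcd_dvd1 gcd_dvd2 dvd_trans)+
  then obtain n' s' t' where e: "n = d * n'" "s = d * s'" "t = d * t'" by (auto elim!: dvdE)
  have n': "n' > 0" using n d0 e by (simp add: zero_less_mult_iff)
  have "d * gcd n' (gcd s' t') = d"
  proof -
    have "gcd (d * n') (gcd (d * s') (d * t')) = d * gcd n' (gcd s' t')"
      using d0 by (simp add: gcd_mult_distrib_int[symmetric])
    moreover have "gcd (d * n') (gcd (d * s') (d * t')) = d"
      by (simp only: e(1)[symmetric] e(2)[symmetric] e(3)[symmetric] d_def[symmetric])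
    ultimately show ?thesis by simp
  qed
  then have st': "gcd n' (gcd s' t') = 1" using d0 by simp
  have "gcd n' (gcd m k) dvd gcd n (gcd m k)" by (rule gcd_mono) (simp_all add: e)
  then have mk': "gcd n' (gcd m k) = 1" using mk by simp
  have os: "on_spectrum n m2 m k w (d * x) \<longleftrightarrow> on_spectrum n' m2 m k w x" for x
    using d0 unfolding on_spectrum_def e by (simp add: unit_root_mult_cancel mult.assoc)
  have "n' dvd s' - t' \<or> n' dvd s' + t' \<or> even n' \<and> n' dvd 2 * gcd n' k * gcd n' m"
    using s t d0 os unfolding e
    by (intro on_spectrum_pair_coprime[OF n' st' mk' w]) (simp_all add: mult.assoc)
  moreover have "2 * gcd n' k * gcd n' m dvd 2 * gcd n k * gcd n m"
    by (intro mult_dvd_mono gcd_mono) (simp_all add: e)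
  ultimately have "d * n' dvd d * (s' - t') \<or> d * n' dvd d * (s' + t') \<or>
     even n \<and> d * n' dvd d * (2 * gcd n k * gcd n m)"
    using e(1) d0 dvd_trans by (metis even_mult_iff dvd_mult_cancel_left)
  then show ?thesis by (simp only: e(1)[symmetric] d_def[symmetric] right_diff_distrib distrib_left e(2,3)[symmetric])
qed

text \<open>A prime q of n / gcd n G would divide every d with n dvd d * G.\<close>

lemma dvd_if_locally_dvd:
  fixes n G :: int
  assumes "n > 0" and loc: "\<And>q. prime q \<Longrightarrow> q dvd n \<Longrightarrow> \<exists>d. \<not> q dvd d \<and> n dvd d * G"
  shows "n dvd G"
proof -
  define g where "g = gcd n G"
  have g0: "g > 0" using assms(1) by (simp add: g_def)
  obtain r G' where r: "n = g * r" "G = g * G'" "coprime r G'"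
    using g0 gcd_coprime_exists[of n G] unfolding g_def by (metis mult.commute less_irrefl)
  have "r = 1"
  proof (rule ccontr)
    assume "r \<noteq> 1"
    moreover have "r > 0" using r g0 assms(1) by (simp add: zero_less_mult_iff)
    ultimately obtain q where q: "prime q" "q dvd r" using prime_divisor_exists[of r] by auto
    then obtain d where d: "\<not> q dvd d" "n dvd d * G" using loc[of q] r(1) by auto
    then have "g * r dvd g * (d * G')" by (simp add: r mult_ac)
    then have "r dvd d * G'" using g0 by simp
    then have "r dvd d" using r(3) by (simp add: coprime_dvd_mult_left_iff)
    then show False using d q by (metis dvd_trans)
  qed
  then show ?thesis using r by simp
qed

section \<open>Fourier analysis of polygons\<close>

lemma periodic_cong:
  fixes f :: "int \<Rightarrow> 'a"
  assumes "\<And>j. f (j + n) = f j" and "n dvd x - y"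
  shows "f x = f y"
proof -
  have *: "f (y + n * c) = f y" for c
  proof (induction c rule: int_induct[of _ 0])
    case (step1 i)
    then show ?case using assms(1)[of "y + n * i"] by (simp add: algebra_simps)
  next
    case (step2 i)
    then show ?case using assms(1)[of "y + n * (i - 1)"] by (simp add: algebra_simps)
  qed simp
  obtain c where "x - y = n * c" using assms(2) by (elim dvdE)
  then have "x = y + n * c" by simp
  then show ?thesis using * by simp
qed

lemma periodic_sum_shift:
  fixes f :: "int \<Rightarrow> 'a :: comm_monoid_add"
  assumes n: "n > 0" and per: "\<And>j. f (j + n) = f j"
  shows "(\<Sum>j\<in>{0..<n}. f (j + r)) = (\<Sum>j\<in>{0..<n}. f j)"
proof -
  define g where "g j = (j + r) mod n" for j
  have "inj_on g {0..<n}"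
  proof
    fix x y assume xy: "x \<in> {0..<n}" "y \<in> {0..<n}" "g x = g y"
    then have "n dvd (x + r) - (y + r)" unfolding g_def by (simp only: mod_eq_dvd_iff)
    then have "x mod n = y mod n" by (simp add: mod_eq_dvd_iff)
    then show "x = y" using xy by simp
  qed
  moreover have "g ` {0..<n} \<subseteq> {0..<n}" using n by (auto simp: g_def)
  ultimately have "bij_betw g {0..<n} {0..<n}"
    using endo_inj_surj[of "{0..<n}" g] by (simp add: bij_betw_def)
  then have "(\<Sum>j\<in>{0..<n}. f (g j)) = (\<Sum>j\<in>{0..<n}. f j)" by (rule sum.reindex_bij_betw)
  moreover have "f (g j) = f (j + r)" for j
    by (rule periodic_cong[of f n]) (use per in \<open>simp_all add: g_def mod_eq_dvd_iff[symmetric]\<close>)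
  ultimately show ?thesis by simp
qed

lemma unit_root_add_period:
  assumes "n > 0"
  shows "unit_root n (x * (j + n)) = unit_root n (x * j)"
  using assms by (simp add: distrib_left unit_root_add unit_root_eq_1_iff)

lemma sum_unit_root:
  assumes n: "n > 0"
  shows "(\<Sum>s\<in>{0..<n}. unit_root n (s * x)) = (if n dvd x then of_int n else 0)"
proof (cases "n dvd x")
  case True
  then have "unit_root n (s * x) = 1" for s using n by (simp add: unit_root_eq_1_iff)
  then show ?thesis using True n by simp
next
  case False
  have "(\<Sum>s\<in>{0..<n}. unit_root n (x * (s + 1))) = (\<Sum>s\<in>{0..<n}. unit_root n (x * s))"
    by (rule periodic_sum_shift[OF n]) (rule unit_root_add_period[OF n])
  then have "(\<Sum>s\<in>{0..<n}. unit_root n (s * x)) * (unit_root n x - 1) = 0"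
    by (simp add: distrib_left unit_root_add right_diff_distrib mult.commute[of x] flip: sum_distrib_right)
  moreover have "unit_root n x \<noteq> 1" using False n by (simp add: unit_root_eq_1_iff)
  ultimately show ?thesis using False by simp
qed

definition dft :: "int \<Rightarrow> (int \<Rightarrow> complex) \<Rightarrow> int \<Rightarrow> complex" where
  "dft n p s = (\<Sum>j\<in>{0..<n}. p j * unit_root n (- (s * j))) / of_int n"

lemma inverse_dft:
  assumes n: "n > 0" and per: "\<And>j. p (j + n) = p j"
  shows "p j = (\<Sum>s\<in>{0..<n}. dft n p s * unit_root n (s * j))"
proof -
  have "(\<Sum>s\<in>{0..<n}. dft n p s * unit_root n (s * j)) =
      (\<Sum>s\<in>{0..<n}. \<Sum>i\<in>{0..<n}. p i * unit_root n (s * (j - i)) / of_int n)"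
    unfolding dft_def sum_divide_distrib sum_distrib_right
    by (intro sum.cong refl) (simp add: right_diff_distrib mult.assoc flip: unit_root_add)
  also have "\<dots> = (\<Sum>i\<in>{0..<n}. p i / of_int n * (\<Sum>s\<in>{0..<n}. unit_root n (s * (j - i))))"
    by (subst sum.swap) (simp add: sum_distrib_left)
  also have "\<dots> = (\<Sum>i\<in>{0..<n}. if i = j mod n then p i else 0)"
  proof (intro sum.cong refl)
    fix i assume i: "i \<in> {0..<n}"
    have "n dvd j - i \<longleftrightarrow> i = j mod n" using i by (auto simp flip: mod_eq_dvd_iff)
    then show "p i / of_int n * (\<Sum>s\<in>{0..<n}. unit_root n (s * (j - i))) = (if i = j mod n then p i else 0)"
      using n by (simp add: sum_unit_root)
  qed
  also have "\<dots> = p (j mod n)" using n by simp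
  also have "\<dots> = p j"
    by (rule periodic_cong[of p n]) (use per in \<open>simp_all add: mod_eq_dvd_iff[symmetric]\<close>)
  finally show ?thesis by simp
qed

lemma dft_shift:
  assumes n: "n > 0" and per: "\<And>j. p (j + n) = p j"
  shows "dft n (\<lambda>j. p (j + r)) s = unit_root n (s * r) * dft n p s"
proof -
  have "(\<Sum>j\<in>{0..<n}. p (j + r) * unit_root n (- (s * (j + r)))) =
        (\<Sum>j\<in>{0..<n}. p j * unit_root n (- (s * j)))"
    using unit_root_add_period[OF n, of "- s"]
    by (intro periodic_sum_shift[OF n, of "\<lambda>j. p j * unit_root n (- (s * j))"]) (simp add: per)
  moreover have "(\<Sum>j\<in>{0..<n}. p (j + r) * unit_root n (- (s * j))) =
      unit_root n (s * r) * (\<Sum>j\<in>{0..<n}. p (j + r) * unit_root n (- (s * (j + r))))"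
    unfolding sum_distrib_left
    by (intro sum.cong refl)
       (simp add: distrib_left unit_root_diff unit_root_add unit_root_uminus_inverse field_simps)
  ultimately show ?thesis by (simp add: dft_def)
qed

lemma dft_diff: "dft n (\<lambda>j. p j - q j) s = dft n p s - dft n q s"
  by (simp add: dft_def left_diff_distrib sum_subtractf diff_divide_distrib)

lemma dft_mult: "dft n (\<lambda>j. w * p j) s = w * dft n p s"
  by (simp add: dft_def mult.assoc flip: sum_distrib_left)

text \<open>Combined with its complex conjugate, the spectral equation becomes w e(s k) = cnj w e(s
  (m1 + m2)).\<close>

lemma on_spectrum_real_iff:
  assumes n: "n > 0" and w: "w \<noteq> 0"
    and s: "on_spectrum n m2 (m1 - m2) k w s" "\<not> n dvd s * k"
  shows "w \<in> \<real> \<longleftrightarrow> n dvd s * (m1 + m2 - k)"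
proof -
  define E M K where "E = unit_root n (s * m2)" "M = unit_root n (s * (m1 - m2))" "K = unit_root n (s * k)"
  have nz: "E \<noteq> 0" "M \<noteq> 0" "K \<noteq> 0" "K \<noteq> 1" using s(2) n by (simp_all add: E_M_K_def unit_root_eq_1_iff)
  have R: "E * (M - 1) = w * (K - 1)" using s(1) by (simp add: on_spectrum_def E_M_K_def)
  have "cnj (E * (M - 1)) = cnj (w * (K - 1))" using R by simp
  moreover have "cnj E = inverse E" "cnj M = inverse M" "cnj K = inverse K"
    by (simp_all add: E_M_K_def flip: unit_root_uminus unit_root_uminus_inverse)
  ultimately have "inverse E * (inverse M - 1) = cnj w * (inverse K - 1)" by simp
  then have "(M - 1) * K = cnj w * (K - 1) * (E * M)" using nz by (simp add: field_simps)
  then have "E * ((M - 1) * K) = E * (cnj w * (K - 1) * (E * M))" by simp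
  then have "(K - 1) * (w * K) = (K - 1) * (cnj w * (E^2 * M))" using R by algebra
  then have eq: "w * K = cnj w * (E^2 * M)" using nz by simp
  have "w \<in> \<real> \<longleftrightarrow> cnj w = w" by (metis Reals_cnj_iff)
  also have "\<dots> \<longleftrightarrow> K = E^2 * M"
  proof
    assume "cnj w = w"
    then show "K = E^2 * M" using eq w by simp
  next
    assume "K = E^2 * M"
    then show "cnj w = w" using eq nz by simp
  qed
  also have "E^2 * M = unit_root n (s * m2 + s * m2 + s * (m1 - m2))"
    by (simp only: E_M_K_def power2_eq_square unit_root_add)
  also have "K = \<dots> \<longleftrightarrow> n dvd s * k - (s * m2 + s * m2 + s * (m1 - m2))"
    unfolding E_M_K_def by (rule unit_root_eq_iff[OF n])
  also have "s * k - (s * m2 + s * m2 + s * (m1 - m2)) = - (s * (m1 + m2 - k))"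
    by (simp add: algebra_simps)
  finally show ?thesis by simp
qed

lemma on_spectrum_uminus_real:
  assumes n: "n > 0" and s: "on_spectrum n m2 m k w s" "on_spectrum n m2 m k w (- s)" "\<not> n dvd s * k"
  shows "w \<in> \<real>"
proof -
  have "cnj (unit_root n (s * m2) * (unit_root n (s * m) - 1)) = cnj (w * (unit_root n (s * k) - 1))"
    using s(1) by (simp add: on_spectrum_def)
  then have "cnj w * (unit_root n (- (s * k)) - 1) = w * (unit_root n (- (s * k)) - 1)"
    using s(2) by (simp add: on_spectrum_def flip: unit_root_uminus)
  moreover have "unit_root n (- (s * k)) \<noteq> 1" using n s(3) by (simp add: unit_root_eq_1_iff)
  ultimately show ?thesis by (simp add: Reals_cnj_iff)
qed

text \<open>For |A| = |B| the ellipse collapses to a segment in the direction of a square root v of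
  A B: the quotient of A z + B cnj z by v is invariant under conjugation.\<close>

lemma collinear_degenerate_ellipse:
  assumes "A \<noteq> 0" "norm A = norm B"
  shows "collinear ((\<lambda>z. C + A * z + B * cnj z) ` S)"
proof -
  define v where "v = csqrt (A * B)"
  have v2: "v^2 = A * B" by (simp add: v_def)
  have "B \<noteq> 0" using assms by auto
  with v2 assms have v0: "v \<noteq> 0" by auto
  have "norm v ^ 2 = norm B ^ 2" using arg_cong[OF v2, of norm] assms(2)
    by (simp add: norm_power norm_mult power2_eq_square)
  then have "v * cnj v = B * cnj B" by (simp add: complex_norm_square[symmetric] flip: of_real_power)
  then have "v * (A * cnj v) = v * (v * cnj B)" using v2 by (simp add: power2_eq_square mult_ac)
  then have 1: "A * cnj v = v * cnj B" using v0 by simp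
  from arg_cong[OF 1, of cnj] have 2: "cnj A * v = cnj v * B" by simp
  have real: "\<exists>c. A * z + B * cnj z = c *\<^sub>R v" for z
  proof -
    define q where "q = (A * z + B * cnj z) / v"
    have "(A * z + B * cnj z) * cnj v = (cnj A * cnj z + cnj B * z) * v"
      using 1 2 by algebra
    then have "cnj q = q" using v0 by (simp add: q_def field_simps)
    then have "q = of_real (Re q)" by (metis Reals_cnj_iff of_real_Re)
    then have "A * z + B * cnj z = of_real (Re q) * v" using v0 by (metis q_def nonzero_eq_divide_eq)
    then show ?thesis by (auto simp: scaleR_conv_of_real)
  qed
  show ?thesis unfolding collinear_def
  proof (intro exI[of _ v] ballI)
    fix x y assume "x \<in> (\<lambda>z. C + A * z + B * cnj z) ` S" "y \<in> (\<lambda>z. C + A * z + B * cnj z) ` S"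
    then obtain z z' where "x = C + A * z + B * cnj z" "y = C + A * z' + B * cnj z'" by auto
    then have "x - y = A * (z - z') + B * cnj (z - z')" by (simp add: algebra_simps)
    then show "\<exists>c. x - y = c *\<^sub>R v" using real by metis
  qed
qed

text \<open>The real-linear map z |-> A z + B cnj z has determinant |A|^2 - |B|^2. Being invertible,
  it transports multiplication by E to the ellipse.\<close>

lemma affine_transformation_rotate_ellipse:
  assumes AB: "norm A \<noteq> norm B" and E: "E \<noteq> 0"
  shows "\<exists>\<phi>. affine_transformation \<phi> \<and>
    (\<forall>z. \<phi> (C + A * z + B * cnj z) = C + A * (E * z) + B * cnj (E * z))"
proof -
  define L where "L z = A * z + B * cnj z" for z
  define d where "d = A * cnj A - B * cnj B"
  \<comment> \<open>Cramer's rule for y = A z + B cnj z and its conjugate.\<close>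
  define L' where "L' y = (cnj A * y - B * cnj y) / d" for y
  have "d = of_real ((norm A)^2 - (norm B)^2)"
    by (simp add: d_def complex_norm_square[symmetric] flip: of_real_power)
  moreover have "(norm A)^2 - (norm B)^2 \<noteq> 0" using AB by (simp add: power2_eq_iff_nonneg)
  ultimately have d: "d \<noteq> 0" "cnj d = d" by (metis of_real_eq_0_iff, metis complex_cnj_complex_of_real)
  have L'L: "L' (L z) = z" for z
    unfolding L_def L'_def using d(1) by (simp add: field_simps) (simp add: d_def algebra_simps)
  have LL': "L (L' y) = y" for y
    unfolding L_def L'_def using d by (simp add: field_simps) (simp add: d_def algebra_simps)
  define M where "M y = L (E * L' y)" for y
  have "linear M"
  proof (rule linearI)
    show "M (x + y) = M x + M y" for x y
      by (simp add: M_def L_def L'_def add_divide_distrib diff_divide_distrib algebra_simps)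
    show "M (r *\<^sub>R x) = r *\<^sub>R M x" for r x
      by (simp add: M_def L_def L'_def scaleR_conv_of_real algebra_simps add_divide_distrib diff_divide_distrib)
  qed
  moreover have "bij M"
    by (rule o_bij[of "\<lambda>y. L (inverse E * L' y)"]) (simp_all add: M_def L'L LL' E fun_eq_iff flip: mult.assoc)
  ultimately have "affine_transformation (\<lambda>z. M z + (C - M C))"
    unfolding affine_transformation_def by blast
  moreover have "M (C + A * z + B * cnj z) + (C - M C) = C + A * (E * z) + B * cnj (E * z)" for z
  proof -
    have "M (C + L z) = M C + M (L z)" using \<open>linear M\<close> by (rule linear_add)
    then show ?thesis by (simp add: M_def L'L) (simp add: L_def add.assoc)
  qed
  ultimately show ?thesis by blast
qed

text \<open>The guard against collinear vertices has content: for real w both s and - s may occur,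
  and a generic projection of a regular polygon to a line keeps the relation and the distinctness of
  the vertices without being affinely regular.\<close>

theorem theorem2:
  fixes n m1 m2 k :: int and p :: "int \<Rightarrow> complex" and w :: complex
  assumes "n \<ge> 4"
    and "\<not> n dvd k" and "\<not> n dvd (m1 - m2)"
    and "gcd n (gcd k (m1 - m2)) = 1"
    and "even n \<Longrightarrow> n > 2 * gcd n k * gcd n (m1 - m2)"
    and "ngon n p"
    and "cmod w \<noteq> 1"
    and "\<forall>j\<in>{1..n}. p (j + m1) - p (j + m2) = w * (p (j + k) - p j)"
  shows "(w \<notin> \<real> \<longrightarrow> regular_ngon n p \<and> \<not> [m1 + m2 = k] (mod n)) \<and>
         (w \<in> \<real> \<longrightarrow> (\<not> collinear (p ` {1..n}) \<longrightarrow> affinely_regular_ngon n p) \<and> [m1 + m2 = k] (mod n))"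
proof -
  define m where "m = m1 - m2"
  have n0: "n > 0" using assms(1) by simp
  have per: "p (j + n) = p j" for j using assms(6) by (simp add: ngon_def)
  have mk: "gcd n (gcd m k) = 1" using assms(4) by (simp add: m_def gcd.commute)
  have rel: "p (j + m1) - p (j + m2) = w * (p (j + k) - p j)" for j
  proof -
    define f where "f j = p (j + m1) - p (j + m2) - w * (p (j + k) - p j)" for j
    have per2: "p (j + n + r) = p (j + r)" for j r using per[of "j + r"] by (simp add: add_ac)
    \<comment> \<open>The representative of j in {1..n}, where the relation is assumed.\<close>
    have "f j = f ((j - 1) mod n + 1)"
    proof (rule periodic_cong)
      show "f (j + n) = f j" for j by (simp add: f_def per2 per)
      have "j - ((j - 1) mod n + 1) = n * ((j - 1) div n)"
        by (simp add: minus_mod_eq_mult_div[symmetric])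
      then show "n dvd j - ((j - 1) mod n + 1)" by simp
    qed
    also have "(j - 1) mod n + 1 \<in> {1..n}" using n0 by (simp add: add1_zle_eq)
    then have "f ((j - 1) mod n + 1) = 0" using assms(8) by (simp add: f_def)
    finally show ?thesis by (simp add: f_def)
  qed
  have inj: "n dvd x - y" if "p x = p y" for x y
  proof -
    define r where "r x = (x - 1) mod n + 1" for x
    have r: "n dvd x - r x" "r x \<in> {1..n}" for x
    proof -
      have "x - r x = n * ((x - 1) div n)" by (simp add: r_def minus_mod_eq_mult_div[symmetric])
      then show "n dvd x - r x" by simp
      show "r x \<in> {1..n}" using n0 by (simp add: r_def add1_zle_eq)
    qed
    have "p (r x) = p (r y)" using periodic_cong[of p n, OF per r(1)] that by metis
    then have "r x = r y" using assms(6) r(2) unfolding ngon_def inj_on_def by blast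
    then have "x - y = (x - r x) - (y - r y)" by simp
    then show ?thesis using r(1) by (metis dvd_diff)
  qed
  have w0: "w \<noteq> 0"
  proof
    assume "w = 0"
    then have "p m1 = p m2" using rel[of 0] by simp
    then show False using inj assms(3) by blast
  qed
  define a where "a = dft n p"
  have a_cong: "a s = a t" if "n dvd s - t" for s t
  proof -
    have "unit_root n (- (s * j)) = unit_root n (- (t * j))" for j
    proof -
      have "- (s * j) - - (t * j) = - (s - t) * j" by (simp add: algebra_simps)
      moreover have "n dvd - (s - t) * j" using that by (simp only: dvd_mult2 dvd_minus_iff)
      ultimately show ?thesis using n0 by (simp only: unit_root_eq_iff)
    qed
    then show ?thesis by (simp add: a_def dft_def)
  qed
  have spec: "on_spectrum n m2 m k w s" if "a s \<noteq> 0" for s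
  proof -
    have "dft n (\<lambda>j. p (j + m1) - p (j + m2)) s = dft n (\<lambda>j. w * (p (j + k) - p j)) s"
      by (simp add: rel)
    then have "(unit_root n (s * m1) - unit_root n (s * m2)) * a s = w * (unit_root n (s * k) - 1) * a s"
      by (simp add: dft_diff dft_mult dft_shift[of n p, OF n0 per] a_def algebra_simps)
    moreover have "unit_root n (s * m1) = unit_root n (s * m2) * unit_root n (s * m)"
      by (simp add: m_def right_diff_distrib flip: unit_root_add)
    ultimately show ?thesis using that by (simp add: on_spectrum_def right_diff_distrib)
  qed
  have p_eq: "p j = (\<Sum>s\<in>{0..<n}. a s * unit_root n (s * j))" for j
    unfolding a_def using inverse_dft[of n p j] n0 per by blast
  define S where "S = {s. a s \<noteq> 0 \<and> \<not> n dvd s}"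
  have Sspec: "on_spectrum n m2 m k w s" if "s \<in> S" for s using that spec by (simp add: S_def)
  have Sk: "\<not> n dvd s * k" if "s \<in> S" for s
  proof
    assume k: "n dvd s * k"
    then have "unit_root n (s * m) = 1"
      using Sspec[OF that] n0 by (simp add: on_spectrum_def unit_root_eq_1_iff[of n "s * k", THEN iffD2])
    then have "n dvd s * m" using n0 by (simp add: unit_root_eq_1_iff)
    then have "n dvd s" using k mk by (rule dvd_if_dvd_mult_coprime)
    then show False using that by (simp add: S_def)
  qed
  \<comment> \<open>If q divided all frequencies, P would have period n / q, against distinct
    vertices.\<close>
  have Sprime: "\<exists>s\<in>S. \<not> q dvd s" if q: "prime q" "q dvd n" for q
  proof (rule ccontr)
    assume "\<not> (\<exists>s\<in>S. \<not> q dvd s)"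
    then have qs: "q dvd s" if "a s \<noteq> 0" for s using that q(2) by (auto simp: S_def intro: dvd_trans)
    obtain r where r: "n = q * r" using q(2) by (elim dvdE)
    have "p (0 + r) = p 0"
      unfolding p_eq[of "0 + r"] p_eq[of 0]
    proof (intro sum.cong refl)
      fix s
      show "a s * unit_root n (s * (0 + r)) = a s * unit_root n (s * 0)"
      proof (cases "a s = 0")
        case False
        then have "n dvd s * r" using qs r by simp
        then show ?thesis using n0 by (simp add: unit_root_eq_1_iff)
      qed simp
    qed
    then have "n dvd r" using inj[of r 0] by simp
    moreover have "r > 0" using n0 r prime_gt_0_int[OF q(1)] zero_less_mult_pos[of q r] by simp
    ultimately have "n \<le> r" by (simp add: zdvd_imp_le)
    then show False using r \<open>r > 0\<close> prime_ge_2_int[OF q(1)] by simp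
  qed
  obtain q0 where q0: "prime q0" "q0 dvd n" using assms(1) prime_divisor_exists[of n] by auto
  obtain s where s: "s \<in> S" using Sprime[OF q0] by blast
  have Spm: "n dvd r - s \<or> n dvd r + s" if r: "r \<in> S" for r
  proof (rule ccontr)
    assume nrs: "\<not> (n dvd r - s \<or> n dvd r + s)"
    define G where "G = 2 * gcd n k * gcd n m"
    have pair: "even n \<and> n dvd gcd n (gcd x y) * G" if "x \<in> S" "y \<in> S" "\<not> (n dvd x - y \<or> n dvd x + y)" for x y
      using on_spectrum_pair[OF n0 mk w0 assms(7), of m2 x y] that Sspec Sk unfolding G_def by blast
    have "n dvd G"
    proof (rule dvd_if_locally_dvd[OF n0])
      fix q :: int assume q: "prime q" "q dvd n"
      then obtain x where x: "x \<in> S" "\<not> q dvd x" using Sprime by blast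
      \<comment> \<open>x can agree up to sign with only one of r and s.\<close>
      have "\<exists>y\<in>S. \<not> (n dvd x - y \<or> n dvd x + y)"
      proof (rule ccontr)
        assume "\<not> ?thesis"
        then have "n dvd x - r \<or> n dvd x + r" "n dvd x - s \<or> n dvd x + s" using r s by auto
        moreover have "(x - s) - (x - r) = r - s" "(x + s) - (x - r) = r + s"
          "(x + r) - (x - s) = r + s" "(x + r) - (x + s) = r - s" by simp_all
        ultimately show False using nrs dvd_diff by metis
      qed
      then obtain y where "n dvd gcd n (gcd x y) * G" using pair x by blast
      moreover have "\<not> q dvd gcd n (gcd x y)" using x by simp
      ultimately show "\<exists>d. \<not> q dvd d \<and> n dvd d * G" by blast
    qed
    moreover have "G > 0" using n0 by (simp add: G_def)
    ultimately have "n \<le> G" by (simp add: zdvd_imp_le)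
    moreover have "even n" using pair[OF r s nrs] by blast
    ultimately show False using assms(5) by (simp add: G_def m_def)
  qed
  \<comment> \<open>A common prime of s and n would divide all of S, which consists of s and - s
    modulo n at most.\<close>
  have sn: "coprime s n"
  proof (rule ccontr)
    assume "\<not> coprime s n"
    then obtain q where q: "prime q" "q dvd s" "q dvd n"
      using n0 prime_divisor_exists[of "gcd s n"] by (auto simp: coprime_iff_gcd_eq_1)
    then obtain r where r: "r \<in> S" "\<not> q dvd r" using Sprime by blast
    have "q dvd r - s \<or> q dvd r + s" using Spm[OF r(1)] q(3) dvd_trans by blast
    then show False using r(2) q(2) by (metis dvd_add_left_iff dvd_diff_left_iff)
  qed
  define A B C where "A = a s" and "B = a (- s)" and "C = a 0"
  have A0: "A \<noteq> 0" using s by (simp add: A_def S_def)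
  have p_form: "p j = C + A * unit_root n (s * j) + B * cnj (unit_root n (s * j))" for j
  proof -
    define u v where "u = s mod n" and "v = (- s) mod n"
    have mod_dvd: "n dvd x mod n - x" for x by (simp flip: mod_eq_dvd_iff)
    have uv: "u \<in> {0..<n}" "v \<in> {0..<n}" "n dvd u - s" "n dvd v - - s"
      using n0 mod_dvd[of s] mod_dvd[of "- s"] by (auto simp: u_def v_def)
    have ns: "\<not> n dvd s" using s by (simp add: S_def)
    \<comment> \<open>This makes the residues of s and - s distinct, so that the sum below has three
      separate terms.\<close>
    have n2s: "\<not> n dvd 2 * s"
    proof
      assume "n dvd 2 * s"
      then have "n dvd 2" using sn by (simp add: coprime_dvd_mult_left_iff coprime_commute)
      then show False using assms(1) zdvd_imp_le[of n 2] by simp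
    qed
    have u0: "u \<noteq> 0" using uv(3) ns by auto
    have v0: "v \<noteq> 0" using uv(4) ns by auto
    have "u \<noteq> v"
    proof
      assume "u = v"
      then have "(v - - s) - (u - s) = 2 * s" by simp
      with dvd_diff[OF uv(4) uv(3)] n2s show False by simp
    qed
    have E: "unit_root n (x * j) = unit_root n (y * j)" if "n dvd x - y" for x y
      using that n0 by (simp add: unit_root_eq_iff flip: left_diff_distrib)
    have "p j = (\<Sum>x\<in>{0..<n}. a x * unit_root n (x * j))" by (rule p_eq)
    also have "\<dots> = (\<Sum>x\<in>{0, u, v}. a x * unit_root n (x * j))"
    proof (rule sum.mono_neutral_right)
      show "\<forall>x\<in>{0..<n} - {0, u, v}. a x * unit_root n (x * j) = 0"
      proof
        fix x assume x: "x \<in> {0..<n} - {0, u, v}"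
        then have "\<not> n dvd x" using zdvd_imp_le[of n x] by auto
        have "x \<notin> S"
        proof
          assume "x \<in> S"
          then have "x mod n = u \<or> x mod n = v"
            using Spm[of x] by (auto simp: u_def v_def mod_eq_dvd_iff)
          then show False using x by auto
        qed
        with \<open>\<not> n dvd x\<close> show "a x * unit_root n (x * j) = 0" by (simp add: S_def)
      qed
    qed (use uv n0 in auto)
    also have "\<dots> = a 0 + a u * unit_root n (u * j) + a v * unit_root n (v * j)"
      using u0 v0 \<open>u \<noteq> v\<close> by simp
    also have "a u = A" unfolding A_def by (rule a_cong[OF uv(3)])
    also have "a v = B" unfolding B_def by (rule a_cong[OF uv(4)])
    finally show ?thesis using E[OF uv(3)] E[OF uv(4)] by (simp add: C_def unit_root_uminus)
  qed
  have p_Suc: "unit_root n (s * (j + 1)) = unit_root n s * unit_root n (s * j)" for j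
    by (simp add: distrib_left unit_root_add)
  have "w \<in> \<real> \<longleftrightarrow> n dvd s * (m1 + m2 - k)"
    using on_spectrum_real_iff[OF n0 w0] Sspec[OF s] Sk[OF s] unfolding m_def by blast
  also have "\<dots> \<longleftrightarrow> n dvd m1 + m2 - k"
    using sn by (simp add: coprime_dvd_mult_right_iff coprime_commute)
  also have "\<dots> \<longleftrightarrow> [m1 + m2 = k] (mod n)" by (simp add: cong_iff_dvd_diff)
  finally have real_iff: "w \<in> \<real> \<longleftrightarrow> [m1 + m2 = k] (mod n)" .
  have "regular_ngon n p" if "w \<notin> \<real>"
  proof -
    have B: "B = 0"
      using that on_spectrum_uminus_real[OF n0 Sspec[OF s] spec Sk[OF s]] unfolding B_def by blast
    define \<phi> where "\<phi> z = C + unit_root n s * (z - C)" for z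
    have "plane_isometry \<phi>"
      unfolding plane_isometry_def
    proof (intro allI)
      fix x y
      have "\<phi> x - \<phi> y = unit_root n s * (x - y)" by (simp add: \<phi>_def algebra_simps)
      then show "dist (\<phi> x) (\<phi> y) = dist x y" by (simp add: dist_norm norm_mult)
    qed
    moreover have "\<phi> (p j) = p (j + 1)" for j
      unfolding p_form p_Suc by (simp add: \<phi>_def B)
    ultimately show ?thesis unfolding regular_ngon_def using assms(6) by blast
  qed
  moreover have "affinely_regular_ngon n p" if nc: "\<not> collinear (p ` {1..n})"
  proof -
    have "norm A \<noteq> norm B"
    proof
      assume eq: "norm A = norm B"
      have "p ` {1..n} = (\<lambda>z. C + A * z + B * cnj z) ` (\<lambda>j. unit_root n (s * j)) ` {1..n}"
        by (simp add: image_image flip: p_form)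
      then show False using nc collinear_degenerate_ellipse[OF A0 eq] by simp
    qed
    then obtain \<phi> where \<phi>: "affine_transformation \<phi>"
      "\<And>z. \<phi> (C + A * z + B * cnj z) = C + A * (unit_root n s * z) + B * cnj (unit_root n s * z)"
      using affine_transformation_rotate_ellipse[of A B "unit_root n s" C] by auto
    have "\<phi> (p j) = p (j + 1)" for j unfolding p_form p_Suc by (rule \<phi>(2))
    then show ?thesis unfolding affinely_regular_ngon_def using \<phi>(1) assms(6) by blast
  qed
  ultimately show ?thesis using real_iff by blast
qed

end
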